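(* Let $V\subset\mathbf{R}^3$ be a rational polytop, let $G=G(V)$ and let $\Omega\subset S^2$ be a fundamental polygon for the action of $G$ on $S^2$. For any $\omega\in\Omega$ the directional billiard map $T_\omega:S\to S$ is a generalized polygon exchange, and $h(T_\omega)=0$.
   Context: $V$ is a closed connected polytop (3-dimensional compact Euclidean polyhedron) with faces $F_i$, $i\in I$. $G(V)\subset O(3)$ is the group generated by the reflections in the planes through the origin parallel to the faces $F_i$; $V$ is rational if $G(V)$ is finite. The billiard flow in $V$ moves a point with unit velocity along straight lines, reflecting elastically at $\partial V$; since reflections lie in $G$, the direction of a trajectory starting in direction $\omega$ stays in the orbit $G\omega$. The directional billiard flow $T^t_\omega$ is the restriction of the billiard flow to phase points with direction in $G\omega$; its cross-section $S$ consists of pairs (point of a face $F_i$, direction $g\omega$, $g\in G$, pointing into $V$), which for $\omega$ in the interior of $\Omega$ is a surface decomposed into $|I||G|/2$ polygons indexed by pairs $(F_i,g)$; $T_\omega:S\to S$ is the first return map of $T^t_\omega$ to $S$. A generalized polygon exchange on a partition $\mathcal{R}$ of a surface $S$ composed of polygons is a map whose restriction to each atom of $\mathcal{R}$ is a homeomorphism onto its image, smooth on interiors, images forming a partition, with $T$ and $T^{-1}$ continuous on atoms; here $\mathcal{R}$ is the partition of $S$ by the discontinuity lines of $T_\omega$. With $\mathcal{R}_n=\bigvee_{k=0}^{n-1}T_\omega^{-k}\mathcal{R}$ (atoms: intersections of atoms of the $T_\omega^{-k}\mathcal{R}$), $h(T_\omega,\mathcal{U})=\limsup_n\frac1n\log(\text{number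 of atoms of }\mathcal{U}_n)$ and $h(T_\omega)=\sup_{\mathcal{U}}h(T_\omega,\mathcal{U})$ over partitions $\mathcal{U}$ refining $\mathcal{R}$. *)

theory Defs
  imports "HOL-Analysis.Analysis" "HOL-Library.Liminf_Limsup"
begin

type_synonym pt = "real^3"
type_synonym phase = "pt \<times> pt"   (* (position, direction) *)

definition closed_polygon :: "pt set \<Rightarrow> bool" where
  "closed_polygon P \<longleftrightarrow>
     (\<exists>Q. finite Q \<and> Q \<noteq> {} \<and>
          (\<forall>q\<in>Q. \<exists>X. finite X \<and> q = convex hull X \<and> aff_dim q = 2) \<and>
          P = \<Union>Q) \<and> aff_dim P = 2"

definition reflect :: "pt \<Rightarrow> pt \<Rightarrow> pt" where
  "reflect n v = v - (2 * (n \<bullet> v)) *\<^sub>R n"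

definition polytop :: "pt set \<Rightarrow> 'i set \<Rightarrow> ('i \<Rightarrow> pt set) \<Rightarrow> ('i \<Rightarrow> pt) \<Rightarrow> bool" where
  "polytop V I F N \<longleftrightarrow>
     finite I \<and> I \<noteq> {} \<and> compact V \<and> connected V \<and> closure (interior V) = V \<and>
     frontier V = (\<Union>i\<in>I. F i) \<and>
     (\<forall>i\<in>I. closed_polygon (F i) \<and> norm (N i) = 1 \<and>
        (\<forall>x\<in>F i. \<forall>y\<in>F i. N i \<bullet> (x - y) = 0) \<and>
        (\<forall>x\<in>rel_interior (F i) - (\<Union>k\<in>I-{i}. F k).
            \<exists>e>0. \<forall>t. 0 < t \<and> t < e \<longrightarrow>
               x + t *\<^sub>R N i \<in> interior V \<and> x - t *\<^sub>R N i \<notin> V)) \<and>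
     (\<forall>i\<in>I. \<forall>j\<in>I. i \<noteq> j \<longrightarrow> rel_interior (F i) \<inter> rel_interior (F j) = {})"

text \<open>G(V): the group generated by the reflections in the planes through the origin
  parallel to the faces (generated as a monoid; the generators are involutions).\<close>
inductive_set refl_group :: "'i set \<Rightarrow> ('i \<Rightarrow> pt) \<Rightarrow> (pt \<Rightarrow> pt) set"
  for I :: "'i set" and N :: "'i \<Rightarrow> pt" where
  refl_group_id: "id \<in> refl_group I N"
| refl_group_step: "g \<in> refl_group I N \<Longrightarrow> i \<in> I \<Longrightarrow> reflect (N i) \<circ> g \<in> refl_group I N"

definition rational_polytop :: "pt set \<Rightarrow> 'i set \<Rightarrow> ('i \<Rightarrow> pt set) \<Rightarrow> ('i \<Rightarrow> pt) \<Rightarrow> bool" where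
  "rational_polytop V I F N \<longleftrightarrow> polytop V I F N \<and> finite (refl_group I N)"

definition sph_interior :: "pt set \<Rightarrow> pt set" where
  "sph_interior \<Omega> = {x\<in>\<Omega>. \<exists>e>0. ball x e \<inter> sphere 0 1 \<subseteq> \<Omega>}"

definition fundamental_polygon :: "(pt \<Rightarrow> pt) set \<Rightarrow> pt set \<Rightarrow> bool" where
  "fundamental_polygon G \<Omega> \<longleftrightarrow>
     \<Omega> \<subseteq> sphere 0 1 \<and> closed \<Omega> \<and> closure (sph_interior \<Omega>) = \<Omega> \<and>
     (\<Union>g\<in>G. g ` \<Omega>) = sphere 0 1 \<and>
     (\<forall>g\<in>G. \<forall>h\<in>G. g \<noteq> h \<longrightarrow> g ` sph_interior \<Omega> \<inter> h ` sph_interior \<Omega> = {}) \<and>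
     (\<exists>W. finite W \<and> 0 \<notin> W \<and>
          \<Omega> - sph_interior \<Omega> \<subseteq> (\<Union>w\<in>W. {x\<in>sphere 0 1. w \<bullet> x = 0}))"

definition cross_section :: "'i set \<Rightarrow> ('i \<Rightarrow> pt set) \<Rightarrow> ('i \<Rightarrow> pt) \<Rightarrow> pt \<Rightarrow> phase set" where
  "cross_section I F N \<omega> =
     {(x, v). v \<in> (\<lambda>g. g \<omega>) ` refl_group I N \<and> (\<exists>i\<in>I. x \<in> F i \<and> N i \<bullet> v > 0)}"

definition exit_time :: "pt set \<Rightarrow> pt \<Rightarrow> pt \<Rightarrow> real" where
  "exit_time V x v = Inf {t. t > 0 \<and> x + t *\<^sub>R v \<notin> interior V}"

definition hit_point :: "pt set \<Rightarrow> pt \<Rightarrow> pt \<Rightarrow> pt" where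
  "hit_point V x v = x + exit_time V x v *\<^sub>R v"

definition billiard_map :: "pt set \<Rightarrow> 'i set \<Rightarrow> ('i \<Rightarrow> pt set) \<Rightarrow> ('i \<Rightarrow> pt) \<Rightarrow> phase \<Rightarrow> phase" where
  "billiard_map V I F N p =
     (let y = hit_point V (fst p) (snd p);
          j = (THE j. j \<in> I \<and> y \<in> rel_interior (F j))
      in (y, reflect (N j) (snd p)))"

definition regular_set :: "pt set \<Rightarrow> 'i set \<Rightarrow> ('i \<Rightarrow> pt set) \<Rightarrow> ('i \<Rightarrow> pt) \<Rightarrow> pt \<Rightarrow> phase set" where
  "regular_set V I F N \<omega> =
     {(x, v). (x, v) \<in> cross_section I F N \<omega> \<and>
        (\<exists>i\<in>I. x \<in> rel_interior (F i) \<and> N i \<bullet> v > 0 \<and> (\<forall>k\<in>I-{i}. x \<notin> F k)) \<and>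
        (\<exists>j\<in>I. hit_point V x v \<in> rel_interior (F j) \<and>
                (\<forall>k\<in>I-{j}. hit_point V x v \<notin> F k))}"

definition discont_partition :: "pt set \<Rightarrow> 'i set \<Rightarrow> ('i \<Rightarrow> pt set) \<Rightarrow> ('i \<Rightarrow> pt) \<Rightarrow> pt \<Rightarrow> phase set set" where
  "discont_partition V I F N \<omega> =
     {connected_component_set (regular_set V I F N \<omega>) p | p. p \<in> regular_set V I F N \<omega>}"

definition open_polygon :: "phase set \<Rightarrow> bool" where
  "open_polygon A \<longleftrightarrow>
     (\<exists>P v. A = P \<times> {v} \<and> P \<noteq> {} \<and> bounded P \<and> aff_dim P = 2 \<and> rel_interior P = P \<and>
        (\<exists>L. finite L \<and> rel_frontier P \<subseteq> (\<Union>(a, b)\<in>L. closed_segment a b)))"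

text \<open>A partition of S into polygons (atoms open, boundaries of measure zero).\<close>
definition polygon_partition :: "phase set \<Rightarrow> phase set set \<Rightarrow> bool" where
  "polygon_partition S U \<longleftrightarrow>
     finite U \<and> (\<forall>A\<in>U. open_polygon A \<and> A \<subseteq> S) \<and> pairwise disjnt U \<and>
     S \<subseteq> closure (\<Union>U)"

definition refines :: "'a set set \<Rightarrow> 'a set set \<Rightarrow> bool" where
  "refines U R \<longleftrightarrow> (\<forall>A\<in>U. \<exists>B\<in>R. A \<subseteq> B)"

fun iter_diff_ok :: "'a::real_normed_vector set \<Rightarrow> ('a \<Rightarrow> 'b::real_normed_vector) \<Rightarrow> 'a list \<Rightarrow> bool" where
  "iter_diff_ok W f [] = continuous_on W f"
| "iter_diff_ok W f (u # us) =
     (f differentiable_on W \<and> iter_diff_ok W (\<lambda>x. frechet_derivative f (at x) u) us)"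

definition smooth_on :: "'a::real_normed_vector set \<Rightarrow> ('a \<Rightarrow> 'b::real_normed_vector) \<Rightarrow> bool" where
  "smooth_on W f \<longleftrightarrow> open W \<and> (\<forall>us. iter_diff_ok W f us)"

definition gen_polygon_exchange :: "phase set \<Rightarrow> phase set set \<Rightarrow> (phase \<Rightarrow> phase) \<Rightarrow> bool" where
  "gen_polygon_exchange S R T \<longleftrightarrow>
     polygon_partition S R \<and>
     (\<forall>A\<in>R. (\<exists>g. homeomorphism A (T ` A) T g) \<and>
             (\<exists>W \<Phi>. A \<subseteq> W \<and> smooth_on W \<Phi> \<and> (\<forall>p\<in>A. \<Phi> p = T p))) \<and>
     (\<forall>A\<in>R. \<forall>B\<in>R. A \<noteq> B \<longrightarrow> T ` A \<inter> T ` B = {}) \<and>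
     polygon_partition S ((\<lambda>A. T ` A) ` R)"

definition join_atoms :: "('a \<Rightarrow> 'a) \<Rightarrow> 'a set set \<Rightarrow> nat \<Rightarrow> 'a set set" where
  "join_atoms T U n =
     {C. C \<noteq> {} \<and> (\<exists>f. (\<forall>k<n. f k \<in> U) \<and> C = {p. \<forall>k<n. (T ^^ k) p \<in> f k})}"

definition partition_entropy :: "('a \<Rightarrow> 'a) \<Rightarrow> 'a set set \<Rightarrow> ereal" where
  "partition_entropy T U =
     limsup (\<lambda>n. ereal (ln (real (card (join_atoms T U n))) / real n))"

definition poly_entropy :: "phase set \<Rightarrow> phase set set \<Rightarrow> (phase \<Rightarrow> phase) \<Rightarrow> ereal" where
  "poly_entropy S R T =
     (SUP U \<in> {U. polygon_partition S U \<and> refines U R}. partition_entropy T U)"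

end

theory Submission
  imports Defs
begin

text \<open>
  A trajectory that starts off the finitely many planes through edges and parallel to its direction
  meets the next face away from the edges, and nearby trajectories meet the same face; so on each
  component of the regular set the map is the projection along the direction between two face
  planes. Such planes cut each face into finitely many cells, whence finitely many polygons. Running
  trajectories backwards gives the same description of the images.

  For the entropy, let \<open>W\<close> be the finite set of normals of all planes that contain a boundary
  segment of an atom and are parallel to its direction, closed under the finite reflection group.
  For a phase point \<open>(x, v)\<close> and \<open>w \<in> W\<close> orthogonal to \<open>v\<close>, the coordinate
  \<open>w \<bullet> x\<close> is constant along the flight and a bounce only adds a constant to it and relabels
  \<open>w\<close>. Hence the atoms of the \<open>n\<close>-fold join are bounded by level sets of these coordinates at
  finitely many levels, and the map does not change coordinate distances. A set smaller than the
  gaps between the levels for \<open>L\<close> steps is cut at most once per \<open>w\<close>, so into at most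
  \<open>2 ^ card W\<close> itineraries of length \<open>L\<close>, and each piece stays small under the iteration. This
  bounds the entropy by \<open>card W * ln 2 / L\<close> for every \<open>L\<close>.
\<close>

section \<open>Hyperplanes and polygons\<close>

lemma affine_hull_eq_hyperplane:
  fixes S :: "'a::euclidean_space set"
  assumes "S \<subseteq> {x. n \<bullet> x = c}" "n \<noteq> 0" "aff_dim S = DIM('a) - 1"
  shows "affine hull S = {x. n \<bullet> x = c}"
proof (rule affine_dim_equal)
  show "affine hull S \<subseteq> {x. n \<bullet> x = c}"
    by (rule hull_minimal[OF assms(1)]) (rule affine_hyperplane)
  have "int DIM('a) - 1 \<noteq> - 1" by simp
  then show "affine hull S \<noteq> {}" using assms(3) by (auto simp del: DIM_positive)
  show "aff_dim (affine hull S) = aff_dim {x. n \<bullet> x = c}"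
    using assms by (simp add: aff_dim_hyperplane)
qed (auto simp: affine_hyperplane)

lemma exists_nonzero_orthogonal_to_two:
  fixes u v :: "'a::euclidean_space"
  assumes "3 \<le> DIM('a)"
  shows "\<exists>w. w \<noteq> 0 \<and> w \<bullet> u = 0 \<and> w \<bullet> v = 0"
proof -
  have "dim {u, v} \<le> card {u, v}" by (rule dim_le_card') simp
  also have "\<dots> \<le> 2" by (simp add: card_insert_if)
  finally have "dim {u, v} < DIM('a)" using assms by simp
  then obtain w where "w \<noteq> 0" "\<And>y. y \<in> span {u, v} \<Longrightarrow> orthogonal w y"
    using orthogonal_to_subspace_exists by blast
  then show ?thesis by (metis insertCI orthogonal_def span_base)
qed

lemma exists_point_on_transversal_hyperplanes:
  fixes n v w :: "'a::real_inner"
  assumes "w \<noteq> 0" "w \<bullet> v = 0" "n \<bullet> v \<noteq> 0"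
  shows "\<exists>x. n \<bullet> x = c \<and> w \<bullet> x = d"
proof -
  define u where "u = w - ((n \<bullet> w) / (n \<bullet> v)) *\<^sub>R v"
  have "n \<bullet> u = 0" "w \<bullet> u = w \<bullet> w"
    using assms by (simp_all add: u_def inner_diff_right)
  then have "n \<bullet> ((c / (n \<bullet> v)) *\<^sub>R v + (d / (w \<bullet> w)) *\<^sub>R u) = c"
    "w \<bullet> ((c / (n \<bullet> v)) *\<^sub>R v + (d / (w \<bullet> w)) *\<^sub>R u) = d"
    using assms by (simp_all add: inner_add_right)
  then show ?thesis by blast
qed

lemma aff_dim_transversal_hyperplanes:
  fixes n v w :: "'a::euclidean_space"
  assumes "w \<noteq> 0" "w \<bullet> v = 0" "n \<bullet> v \<noteq> 0"
  shows "aff_dim ({x. n \<bullet> x = c} \<inter> {x. w \<bullet> x = d}) = int DIM('a) - 2"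
proof -
  have "{x. n \<bullet> x = c} \<inter> {x. w \<bullet> x = d} \<noteq> {}" "\<not> {x. n \<bullet> x = c} \<subseteq> {x. w \<bullet> x = d}"
    using exists_point_on_transversal_hyperplanes[OF assms, of c d]
      exists_point_on_transversal_hyperplanes[OF assms, of c "d + 1"] by auto
  moreover have "n \<noteq> 0" using assms by auto
  ultimately show ?thesis
    by (simp add: aff_dim_affine_Int_hyperplane affine_hyperplane aff_dim_hyperplane)
qed

lemma bounded_transversal_hyperplanes_subset_segment:
  fixes n v w :: "'a::euclidean_space"
  assumes "DIM('a) \<le> 3" "w \<noteq> 0" "w \<bullet> v = 0" "n \<bullet> v \<noteq> 0" "bounded B"
  shows "\<exists>a b. B \<inter> {x. n \<bullet> x = c} \<inter> {x. w \<bullet> x = d} \<subseteq> closed_segment a b"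
proof -
  obtain r where r: "B \<subseteq> cball 0 r"
    using bounded_subset_ballD[OF assms(5), of 0] ball_subset_cball by blast
  let ?T = "cball 0 r \<inter> ({x. n \<bullet> x = c} \<inter> {x. w \<bullet> x = d})"
  have "compact ?T" by (intro compact_Int_closed closed_Int closed_hyperplane) simp
  moreover have "convex ?T" by (intro convex_Int convex_hyperplane) simp
  moreover have "collinear ({x. n \<bullet> x = c} \<inter> {x. w \<bullet> x = d})"
    using aff_dim_transversal_hyperplanes[OF assms(2-4), of c d] assms(1)
    by (simp add: collinear_aff_dim)
  then have "collinear ?T" by (rule collinear_subset) auto
  ultimately obtain a b where "?T = {} \<or> ?T = closed_segment a b"
    using compact_convex_collinear_segment[of ?T] by metis
  then have "?T \<subseteq> closed_segment a b" by (metis empty_subsetI order_refl)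
  then show ?thesis using r by blast
qed

definition planes_Union :: "('a::real_inner \<times> real) set \<Rightarrow> 'a set" where
  "planes_Union K = (\<Union>(w, d)\<in>K. {x. w \<bullet> x = d})"

definition parallel_planes :: "'a::real_inner \<Rightarrow> ('a \<times> real) set \<Rightarrow> bool" where
  "parallel_planes v K \<longleftrightarrow> finite K \<and> (\<forall>(w, d)\<in>K. w \<noteq> 0 \<and> w \<bullet> v = 0)"

definition planes_below :: "('a::real_inner \<times> real) set \<Rightarrow> 'a \<Rightarrow> ('a \<times> real) set" where
  "planes_below K x = {(w, d)\<in>K. d < w \<bullet> x}"

lemma mem_planes_Union: "x \<in> planes_Union K \<longleftrightarrow> (\<exists>w d. (w, d) \<in> K \<and> w \<bullet> x = d)"
  by (auto simp: planes_Union_def)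

lemma planes_Union_mono: "K \<subseteq> L \<Longrightarrow> planes_Union K \<subseteq> planes_Union L"
  by (auto simp: planes_Union_def)

lemma planes_Union_translate:
  assumes "parallel_planes v K"
  shows "x + t *\<^sub>R v \<in> planes_Union K \<longleftrightarrow> x \<in> planes_Union K"
proof -
  have "w \<bullet> (x + t *\<^sub>R v) = w \<bullet> x" if "(w, d) \<in> K" for w d
    using assms that by (auto simp: parallel_planes_def inner_add_right)
  then show ?thesis unfolding mem_planes_Union by metis
qed

lemma closed_segment_disjoint_planes_Union:
  assumes "x \<notin> planes_Union K" "y \<notin> planes_Union K" "planes_below K x = planes_below K y"
  shows "closed_segment x y \<inter> planes_Union K = {}"
proof -
  have "w \<bullet> z \<noteq> d" if wd: "(w, d) \<in> K" and z: "z \<in> closed_segment x y" for w d z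
  proof -
    have "d < w \<bullet> x \<longleftrightarrow> d < w \<bullet> y" using assms(3) wd by (auto simp: planes_below_def)
    moreover have "w \<bullet> x \<noteq> d" "w \<bullet> y \<noteq> d" using assms(1,2) wd by (auto simp: mem_planes_Union)
    ultimately consider "d < w \<bullet> x" "d < w \<bullet> y" | "w \<bullet> x < d" "w \<bullet> y < d" by linarith
    then have "closed_segment x y \<subseteq> {z. d < w \<bullet> z} \<or> closed_segment x y \<subseteq> {z. w \<bullet> z < d}"
      by cases (simp_all add: closed_segment_subset convex_halfspace_gt convex_halfspace_lt)
    then show ?thesis using z by auto
  qed
  then show ?thesis by (auto simp: planes_Union_def)
qed

lemma openin_hyperplane_subset_closure_diff_hyperplane:
  fixes n v w :: "'a::euclidean_space"
  assumes S: "openin (top_of_set {x. n \<bullet> x = c}) S"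
    and "n \<bullet> v \<noteq> 0" "w \<noteq> 0" "w \<bullet> v = 0"
  shows "S \<subseteq> closure (S - {x. w \<bullet> x = d})"
proof (cases "S = {}")
  case False
  let ?T = "{x. n \<bullet> x = c} \<inter> {x. w \<bullet> x = d}"
  have "n \<noteq> 0" using assms(2) by auto
  then have dim: "aff_dim S = DIM('a) - 1"
    using aff_dim_openin[OF S affine_hyperplane False] by (simp add: aff_dim_hyperplane)
  then have "affine hull S = {x. n \<bullet> x = c}"
    using affine_hull_eq_hyperplane \<open>n \<noteq> 0\<close> openin_imp_subset[OF S] by blast
  then have "openin (top_of_set (affine hull S)) S" using S by simp
  moreover have "aff_dim ?T < aff_dim S"
    using aff_dim_transversal_hyperplanes[OF assms(3,4,2), of c d] dim by simp
  ultimately have "closure (S - ?T) = closure S"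
    by (intro dense_complement_openin_affine_hull)
  moreover have "S - ?T = S - {x. w \<bullet> x = d}" using openin_imp_subset[OF S] by blast
  ultimately show ?thesis by (simp add: closure_subset)
qed simp

lemma openin_hyperplane_subset_closure_diff_planes:
  fixes n v :: "'a::euclidean_space"
  assumes S: "openin (top_of_set {x. n \<bullet> x = c}) S"
    and "n \<bullet> v \<noteq> 0" and K: "parallel_planes v K"
  shows "S \<subseteq> closure (S - planes_Union K)"
proof -
  have "S \<subseteq> closure (S - planes_Union L)" if "finite L" "L \<subseteq> K" for L
    using that
  proof (induction L)
    case empty
    then show ?case by (simp add: planes_Union_def closure_subset)
  next
    case (insert k L)
    obtain w d where k: "k = (w, d)" by (cases k)
    have w: "w \<noteq> 0" "w \<bullet> v = 0" using K insert.prems k by (auto simp: parallel_planes_def)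
    let ?S = "S - planes_Union L"
    have "closed (planes_Union L)"
      unfolding planes_Union_def using insert.hyps by (auto intro!: closed_hyperplane)
    then have "openin (top_of_set {x. n \<bullet> x = c}) ?S"
      using openin_Int_open[OF S open_Compl] by (simp add: Diff_eq)
    then have "?S \<subseteq> closure (?S - {x. w \<bullet> x = d})"
      using assms(2) w by (rule openin_hyperplane_subset_closure_diff_hyperplane)
    also have "?S - {x. w \<bullet> x = d} = S - planes_Union (insert k L)"
      using k by (auto simp: planes_Union_def)
    finally have "closure ?S \<subseteq> closure (S - planes_Union (insert k L))"
      by (simp add: closure_minimal)
    then show ?case using insert by blast
  qed
  then show ?thesis using K by (simp add: parallel_planes_def)
qed

lemma card_image_le_card_image:
  assumes "finite (g ` A)" "\<And>x y. x \<in> A \<Longrightarrow> y \<in> A \<Longrightarrow> g x = g y \<Longrightarrow> f x = f y"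
  shows "finite (f ` A)" "card (f ` A) \<le> card (g ` A)"
proof -
  have "f x = f (inv_into A g (g x))" if "x \<in> A" for x
    using that by (intro assms(2)) (auto simp: inv_into_into f_inv_into_f)
  then have "f ` A = (\<lambda>s. f (inv_into A g s)) ` g ` A" by (force simp: image_image)
  then show "finite (f ` A)" "card (f ` A) \<le> card (g ` A)"
    using assms(1) by (simp_all add: card_image_le)
qed

text \<open>The values of each functional on \<open>A\<close> are so close together that at most one level of
  \<open>Z\<close> separates them.\<close>

lemma card_planes_below_image_le:
  assumes "finite W" and off: "A \<inter> planes_Union (W \<times> Z) = {}"
    and gap: "\<And>a b. a \<in> Z \<Longrightarrow> b \<in> Z \<Longrightarrow> dist a b < \<delta> \<Longrightarrow> a = b"
    and narrow: "\<And>x y w. x \<in> A \<Longrightarrow> y \<in> A \<Longrightarrow> w \<in> W \<Longrightarrow> \<bar>w \<bullet> x - w \<bullet> y\<bar> < \<delta>"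
  shows "finite (planes_below (W \<times> Z) ` A)" "card (planes_below (W \<times> Z) ` A) \<le> 2 ^ card W"
proof -
  define raised where "raised x = {w\<in>W. \<exists>d\<in>Z. d < w \<bullet> x \<and> (\<exists>y\<in>A. w \<bullet> y < d)}" for x
  have below: "planes_below (W \<times> Z) x \<subseteq> planes_below (W \<times> Z) y"
    if xy: "x \<in> A" "y \<in> A" "raised x = raised y" for x y
  proof (rule ccontr)
    assume "\<not> ?thesis"
    then obtain w d where wd: "w \<in> W" "d \<in> Z" "d < w \<bullet> x" "w \<bullet> y \<le> d"
      by (force simp: planes_below_def)
    moreover have "w \<bullet> y \<noteq> d"
      using off xy(2) wd(1,2) by (auto simp: mem_planes_Union disjoint_iff)
    ultimately have "w \<bullet> y < d" by simp
    then have "w \<in> raised x" using xy(2) wd by (auto simp: raised_def)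
    then have "w \<in> raised y" using xy(3) by simp
    then obtain d' z where d': "d' \<in> Z" "d' < w \<bullet> y" "z \<in> A" "w \<bullet> z < d'" by (auto simp: raised_def)
    have "\<bar>w \<bullet> x - w \<bullet> z\<bar> < \<delta>" using narrow xy(1) d'(3) wd(1) by blast
    then have "dist d d' < \<delta>" using wd(3) \<open>w \<bullet> y < d\<close> d' by (simp add: dist_real_def)
    then have "d = d'" using gap wd(2) d'(1) by blast
    then show False using \<open>w \<bullet> y < d\<close> d'(2) by simp
  qed
  have raised_subset: "raised ` A \<subseteq> Pow W" by (auto simp: raised_def)
  then have finite_raised: "finite (raised ` A)"
    using \<open>finite W\<close> by (meson finite_Pow_iff finite_subset)
  have "planes_below (W \<times> Z) x = planes_below (W \<times> Z) y"
    if "x \<in> A" "y \<in> A" "raised x = raised y" for x y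
    using below[OF that] below[OF that(2,1) that(3)[symmetric]] by blast
  note factor = card_image_le_card_image[OF finite_raised, of "planes_below (W \<times> Z)", OF this]
  show "finite (planes_below (W \<times> Z) ` A)" by (rule factor(1))
  have "card (planes_below (W \<times> Z) ` A) \<le> card (raised ` A)" by (rule factor(2))
  also have "\<dots> \<le> card (Pow W)" using raised_subset \<open>finite W\<close> by (simp add: card_mono)
  finally show "card (planes_below (W \<times> Z) ` A) \<le> 2 ^ card W" by (simp add: card_Pow \<open>finite W\<close>)
qed

definition segment_covered :: "'a::real_vector set \<Rightarrow> bool" where
  "segment_covered S \<longleftrightarrow> (\<exists>L. finite L \<and> S \<subseteq> (\<Union>(a, b)\<in>L. closed_segment a b))"

lemma segment_covered_subset: "segment_covered T \<Longrightarrow> S \<subseteq> T \<Longrightarrow> segment_covered S"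
  unfolding segment_covered_def by (meson subset_trans)

lemma segment_covered_closed_segment: "segment_covered (closed_segment a b)"
  unfolding segment_covered_def by (intro exI[of _ "{(a, b)}"]) auto

lemma segment_covered_Un:
  assumes "segment_covered S" "segment_covered T"
  shows "segment_covered (S \<union> T)"
proof -
  obtain L M where "finite L" "S \<subseteq> (\<Union>(a, b)\<in>L. closed_segment a b)"
    "finite M" "T \<subseteq> (\<Union>(a, b)\<in>M. closed_segment a b)"
    using assms unfolding segment_covered_def by blast
  then show ?thesis unfolding segment_covered_def by (intro exI[of _ "L \<union> M"]) auto
qed

lemma segment_covered_UN:
  assumes "finite J" "\<And>i. i \<in> J \<Longrightarrow> segment_covered (S i)"
  shows "segment_covered (\<Union>i\<in>J. S i)"
  using assms
proof (induction J)
  case empty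
  then show ?case by (auto simp: segment_covered_def)
next
  case (insert j J)
  then show ?case by (simp add: segment_covered_Un)
qed

lemma segment_covered_rel_frontier_polytope:
  fixes q :: "'a::euclidean_space set"
  assumes "polytope q" "aff_dim q = 2"
  shows "segment_covered (rel_frontier q)"
proof -
  have "segment_covered f" if "f facet_of q" for f
  proof -
    have f: "f face_of q" "f \<noteq> {}" "aff_dim f = 1" using that assms(2) by (auto simp: facet_of_def)
    then have "polytope f" using assms(1) face_of_polytope_polytope by blast
    then obtain a b where "f = closed_segment a b"
      using f compact_convex_collinear_segment[of f]
      by (auto simp: polytope_imp_compact polytope_imp_convex collinear_aff_dim)
    then show ?thesis by (simp add: segment_covered_closed_segment)
  qed
  moreover have "polyhedron q" using assms(1) by (rule polytope_imp_polyhedron)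
  ultimately show ?thesis
    using segment_covered_UN[OF finite_polyhedron_facets, of q "\<lambda>f. f"]
    by (simp add: rel_frontier_of_polyhedron Union_eq)
qed

lemma segment_covered_subset_parallel_planes:
  fixes v :: "'a::euclidean_space"
  assumes "3 \<le> DIM('a)" "segment_covered S"
  shows "\<exists>K. parallel_planes v K \<and> S \<subseteq> planes_Union K"
proof -
  obtain L where L: "finite L" "S \<subseteq> (\<Union>(a, b)\<in>L. closed_segment a b)"
    using assms(2) unfolding segment_covered_def by blast
  obtain n where n: "\<And>u::'a. n u \<noteq> 0 \<and> n u \<bullet> v = 0 \<and> n u \<bullet> u = 0"
    using exists_nonzero_orthogonal_to_two[OF assms(1)] by metis
  let ?K = "(\<lambda>(a, b). (n (b - a), n (b - a) \<bullet> a)) ` L"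
  have "n (b - a) \<bullet> x = n (b - a) \<bullet> a" if "x \<in> closed_segment a b" for a b x
  proof -
    obtain s where "x = a + s *\<^sub>R (b - a)" using \<open>x \<in> closed_segment a b\<close>
      by (auto simp: closed_segment_def algebra_simps)
    then show ?thesis using n by (simp add: inner_add_right)
  qed
  then have "closed_segment a b \<subseteq> planes_Union ?K" if "(a, b) \<in> L" for a b
    using imageI[OF that, of "\<lambda>(a, b). (n (b - a), n (b - a) \<bullet> a)"]
    unfolding mem_planes_Union subset_iff prod.case by blast
  then have "S \<subseteq> planes_Union ?K" using L(2) by blast
  moreover have "parallel_planes v ?K" using L(1) n by (auto simp: parallel_planes_def)
  ultimately show ?thesis by blast
qed

lemma connected_subset_rel_interior:
  fixes P :: "'a::euclidean_space set"
  assumes "connected C" "C \<subseteq> affine hull P" "C \<inter> rel_interior P \<noteq> {}" "C \<inter> rel_frontier P = {}"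
  shows "C \<subseteq> rel_interior P"
proof -
  have "C \<inter> rel_interior P = C \<inter> closure P"
    using assms(4) rel_interior_subset[of P] closure_subset[of P]
    unfolding rel_frontier_def by blast
  then have "closedin (top_of_set C) (C \<inter> rel_interior P)" by (simp add: closedin_closed_Int)
  moreover have "openin (top_of_set C) (C \<inter> rel_interior P)"
    using continuous_openin_preimage[OF continuous_on_id _ openin_rel_interior, of C P] assms(2)
    by (simp add: Pi_iff subset_eq)
  ultimately show ?thesis using assms(1,3) unfolding connected_clopen by blast
qed

lemma open_polygon_Times_singleton:
  fixes P :: "pt set"
  assumes "P \<noteq> {}" "bounded P" and openin_P: "openin (top_of_set {x. n \<bullet> x = c}) P"
    and transversal: "n \<bullet> v \<noteq> 0" and K: "parallel_planes v K"
    and boundary: "closure P - P \<subseteq> planes_Union K"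
  shows "open_polygon (P \<times> {u})"
proof -
  have n_nonzero: "n \<noteq> 0" using transversal by auto
  have subset_plane: "P \<subseteq> {x. n \<bullet> x = c}" using openin_P by (rule openin_imp_subset)
  have dim: "aff_dim P = 2"
    using aff_dim_openin[OF openin_P affine_hyperplane \<open>P \<noteq> {}\<close>] n_nonzero
    by (simp add: aff_dim_hyperplane)
  then have "affine hull P = {x. n \<bullet> x = c}"
    using affine_hull_eq_hyperplane[OF subset_plane n_nonzero] by simp
  then have rel_interior_P: "rel_interior P = P" using openin_P by (simp add: rel_interior_eq)
  have closure_P: "closure P \<subseteq> {x. n \<bullet> x = c}"
    by (rule closure_minimal[OF subset_plane closed_hyperplane])
  have "segment_covered (\<Union>k\<in>K. closure P \<inter> {x. n \<bullet> x = c} \<inter> {x. fst k \<bullet> x = snd k})"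
  proof (rule segment_covered_UN)
    show "finite K" using K by (simp add: parallel_planes_def)
    fix k assume "k \<in> K"
    then have "fst k \<noteq> 0" "fst k \<bullet> v = 0" using K by (auto simp: parallel_planes_def)
    then show "segment_covered (closure P \<inter> {x. n \<bullet> x = c} \<inter> {x. fst k \<bullet> x = snd k})"
      using bounded_transversal_hyperplanes_subset_segment[of "fst k" v n "closure P" c "snd k"]
        transversal bounded_closure[OF \<open>bounded P\<close>]
        segment_covered_subset[OF segment_covered_closed_segment]
      by auto
  qed
  moreover have "rel_frontier P \<subseteq> (\<Union>k\<in>K. closure P \<inter> {x. n \<bullet> x = c} \<inter> {x. fst k \<bullet> x = snd k})"
    using boundary closure_P
    unfolding rel_frontier_def rel_interior_P planes_Union_def case_prod_unfold by blast
  ultimately have "segment_covered (rel_frontier P)" by (rule segment_covered_subset)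
  then show ?thesis
    unfolding open_polygon_def segment_covered_def using assms(1,2) dim rel_interior_P by blast
qed

section \<open>Topological and smooth preliminaries\<close>

lemma openin_iff_eventually_nhds:
  "openin (top_of_set S) U \<longleftrightarrow> U \<subseteq> S \<and> (\<forall>x\<in>U. \<forall>\<^sub>F y in nhds x. y \<in> S \<longrightarrow> y \<in> U)"
proof
  assume "openin (top_of_set S) U"
  then obtain O' where "open O'" "U = S \<inter> O'" by (auto simp: openin_open)
  then show "U \<subseteq> S \<and> (\<forall>x\<in>U. \<forall>\<^sub>F y in nhds x. y \<in> S \<longrightarrow> y \<in> U)"
    by (auto intro: eventually_mono[OF eventually_nhds_in_open])
next
  assume nbhd: "U \<subseteq> S \<and> (\<forall>x\<in>U. \<forall>\<^sub>F y in nhds x. y \<in> S \<longrightarrow> y \<in> U)"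
  show "openin (top_of_set S) U"
  proof (subst openin_subopen, intro ballI)
    fix x assume "x \<in> U"
    then obtain O' where O': "open O'" "x \<in> O'" "\<forall>y\<in>O'. y \<in> S \<longrightarrow> y \<in> U"
      using bspec[OF conjunct2[OF nbhd] \<open>x \<in> U\<close>] unfolding eventually_nhds by blast
    then have "openin (top_of_set S) (S \<inter> O')" by (simp add: openin_open_Int)
    then show "\<exists>T. openin (top_of_set S) T \<and> x \<in> T \<and> T \<subseteq> U" using nbhd O' \<open>x \<in> U\<close> by blast
  qed
qed

lemma eventually_nhds_isCont:
  assumes "isCont f x" "\<forall>\<^sub>F y in nhds (f x). P y"
  shows "\<forall>\<^sub>F z in nhds x. P (f z)"
proof (rule eventually_compose_filterlim[OF assms(2)])
  show "filterlim f (nhds (f x)) (nhds x)"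
    using assms(1) by (simp add: isCont_def tendsto_at_iff_tendsto_nhds)
qed

lemma eventually_nhds_ball_compact:
  assumes "compact K" "\<And>s. s \<in> K \<Longrightarrow> \<forall>\<^sub>F z in nhds (x, s). P z"
  shows "\<forall>\<^sub>F y in nhds x. \<forall>s\<in>K. P (y, s)"
proof -
  have "(x, s) \<in> interior {z. P z}" if "s \<in> K" for s
    using assms(2)[OF that] unfolding eventually_nhds by (metis interiorI mem_Collect_eq subsetI)
  then have "{x} \<times> K \<subseteq> interior {z. P z}" by blast
  then obtain X where "x \<in> X" "open X" "X \<times> K \<subseteq> interior {z. P z}"
    using Elementary_Topology.tube_lemma[OF assms(1) open_interior] by metis
  then show ?thesis unfolding eventually_nhds using interior_subset by blast
qed

lemma homeomorphism_image_components:
  assumes "homeomorphism S T f g" "C \<in> components S"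
  shows "f ` C \<in> components T"
proof -
  have f: "f ` S = T" "continuous_on S f" "\<And>x. x \<in> S \<Longrightarrow> g (f x) = x"
    and g: "g ` T = S" "continuous_on T g" "\<And>y. y \<in> T \<Longrightarrow> f (g y) = y"
    using assms(1) by (auto simp: homeomorphism_def)
  have C: "C \<noteq> {}" "C \<subseteq> S" "connected C"
    using assms(2) in_components_nonempty in_components_subset in_components_connected by blast+
  have "D = f ` C" if D: "f ` C \<subseteq> D" "D \<subseteq> T" "connected D" for D
  proof -
    have "connected (g ` D)"
      using continuous_on_subset[OF g(2) D(2)] D(3) by (rule connected_continuous_image)
    moreover have "g ` D \<subseteq> S" using image_mono[OF D(2), of g] g(1) by simp
    moreover have "g ` f ` C = C" using f(3) C(2) by (force simp: image_image)
    then have "C \<subseteq> g ` D" using image_mono[OF D(1), of g] by simp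
    ultimately have "g ` D \<subseteq> C" using components_maximal[OF assms(2)] C(1) by blast
    moreover have "f ` g ` D = D" using g(3) D(2) by (force simp: image_image)
    ultimately show ?thesis using D(1) image_mono[of "g ` D" C f] by simp
  qed
  moreover have "connected (f ` C)"
    using continuous_on_subset[OF f(2) C(2)] C(3) by (rule connected_continuous_image)
  moreover have "f ` C \<subseteq> T" using image_mono[OF C(2), of f] f(1) by simp
  ultimately show ?thesis unfolding in_components_maximal using C(1) by simp
qed

lemma connected_disjoint_frontier_cases:
  assumes "connected C" "C \<inter> frontier S = {}"
  shows "C \<subseteq> interior S \<or> C \<inter> S = {}"
proof -
  have "C \<inter> S = C \<inter> interior S"
    using assms(2) interior_subset closure_subset unfolding frontier_def by blast
  then show ?thesis using connected_Int_frontier[OF assms(1), of S] assms(2) by blast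
qed

lemma connected_subset_disjoint_open_member:
  assumes "connected C" "C \<subseteq> \<Union>\<D>" "D \<in> \<D>" "C \<inter> D \<noteq> {}" "pairwise disjnt \<D>"
    and openin_members: "\<And>E. E \<in> \<D> \<Longrightarrow> openin (top_of_set (\<Union>\<D>)) E"
  shows "C \<subseteq> D"
proof -
  have "\<Union>\<D> - D = \<Union>(\<D> - {D})" using assms(3,5) by (auto simp: pairwise_def disjnt_def)
  then have "openin (top_of_set (\<Union>\<D>)) (\<Union>\<D> - D)" using openin_members by (metis DiffD1 openin_Union)
  then have "closedin (top_of_set (\<Union>\<D>)) D" using assms(3) by (auto simp: closedin_def)
  moreover have "connectedin (top_of_set (\<Union>\<D>)) C"
    using assms(1,2) by (simp add: connectedin_subtopology)
  ultimately show ?thesis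
    using connectedin_clopen_cases openin_members[OF assms(3)] assms(4) by (metis disjnt_def)
qed

lemma closedin_imp_eq_Int_closure:
  assumes "closedin (top_of_set S) C"
  shows "C = S \<inter> closure C"
  using assms closure_minimal[of C] closure_subset[of C] unfolding closedin_closed by auto

lemma iter_diff_ok_const: "iter_diff_ok UNIV (\<lambda>x. c) us"
  by (induction us arbitrary: c) (auto simp: frechet_derivative_const)

lemma smooth_on_affine:
  assumes "bounded_linear L"
  shows "smooth_on UNIV (\<lambda>x. L x + b)"
proof -
  have deriv: "((\<lambda>x. L x + b) has_derivative L) (at x)" for x
    using bounded_linear_imp_has_derivative[OF assms] by (auto intro!: derivative_eq_intros)
  have "iter_diff_ok UNIV (\<lambda>x. L x + b) us" for us
  proof (cases us)
    case Nil
    then show ?thesis using linear_continuous_on[OF assms] by (auto intro!: continuous_intros)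
  next
    case (Cons u us')
    have "frechet_derivative (\<lambda>x. L x + b) (at x) = L" for x
      using frechet_derivative_at[OF deriv] by simp
    moreover have "(\<lambda>x. L x + b) differentiable_on UNIV"
      using deriv by (auto simp: differentiable_on_def differentiable_def)
    ultimately show ?thesis by (simp add: Cons iter_diff_ok_const)
  qed
  then show ?thesis by (simp add: smooth_on_def)
qed

section \<open>Local geometry of the boundary\<close>

lemma inner_reflect_reflect: "norm n = 1 \<Longrightarrow> reflect n x \<bullet> reflect n y = x \<bullet> y"
  by (simp add: reflect_def inner_diff_left inner_diff_right inner_commute norm_eq_1)

lemma inner_normal_reflect: "norm n = 1 \<Longrightarrow> n \<bullet> reflect n x = - (n \<bullet> x)"
  by (simp add: reflect_def inner_diff_right norm_eq_1)

lemma reflect_reflect: "norm n = 1 \<Longrightarrow> reflect n (reflect n x) = x"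
  by (simp add: reflect_def inner_diff_right norm_eq_1)

lemma norm_reflect: "norm n = 1 \<Longrightarrow> norm (reflect n x) = norm x"
  by (simp add: norm_eq_sqrt_inner inner_reflect_reflect)

locale polytop_billiard =
  fixes V :: "pt set" and I :: "'i set" and F :: "'i \<Rightarrow> pt set" and N :: "'i \<Rightarrow> pt"
  assumes polytop: "polytop V I F N"
begin

definition offset :: "'i \<Rightarrow> real" where
  "offset i = N i \<bullet> (SOME x. x \<in> F i)"

definition height :: "'i \<Rightarrow> pt \<Rightarrow> real" where
  "height i x = N i \<bullet> x - offset i"

definition face_plane :: "'i \<Rightarrow> pt set" where
  "face_plane i = {x. N i \<bullet> x = offset i}"

definition face_core :: "'i \<Rightarrow> pt set" where
  "face_core i = rel_interior (F i) - (\<Union>k\<in>I-{i}. F k)"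

lemma finite_I: "finite I" and compact_V: "compact V"
  and frontier_V: "frontier V = (\<Union>i\<in>I. F i)"
  and norm_N: "i \<in> I \<Longrightarrow> norm (N i) = 1"
  and polygon_F: "i \<in> I \<Longrightarrow> closed_polygon (F i)"
  using polytop by (auto simp: polytop_def)

lemma inner_N_self: "i \<in> I \<Longrightarrow> N i \<bullet> N i = 1"
  using norm_N by (simp add: norm_eq_1)

lemma N_nonzero: "i \<in> I \<Longrightarrow> N i \<noteq> 0"
  using norm_N by fastforce

lemma mem_face_plane: "x \<in> face_plane i \<longleftrightarrow> height i x = 0"
  by (simp add: face_plane_def height_def)

lemma height_add: "height i (x + t *\<^sub>R v) = height i x + t * (N i \<bullet> v)"
  and height_diff: "height i (x - t *\<^sub>R v) = height i x - t * (N i \<bullet> v)"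
  by (simp_all add: height_def inner_add_right inner_diff_right)

lemma continuous_height [continuous_intros]:
  "continuous net f \<Longrightarrow> continuous net (\<lambda>x. height i (f x))"
  unfolding height_def by (intro continuous_intros)

lemma F_subset_face_plane: "i \<in> I \<Longrightarrow> F i \<subseteq> face_plane i"
proof
  fix x assume i: "i \<in> I" and x: "x \<in> F i"
  then have "(SOME x. x \<in> F i) \<in> F i" by (metis someI)
  then have "N i \<bullet> (x - (SOME x. x \<in> F i)) = 0" using i x polytop by (auto simp: polytop_def)
  then show "x \<in> face_plane i" by (simp add: face_plane_def offset_def inner_diff_right)
qed

lemma affine_hull_eq_face_plane:
  assumes "i \<in> I" "S \<subseteq> face_plane i" "aff_dim S = 2"
  shows "affine hull S = face_plane i"
  using affine_hull_eq_hyperplane[of S "N i" "offset i"] N_nonzero assms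
  by (simp add: face_plane_def)

lemma affine_hull_F: "i \<in> I \<Longrightarrow> affine hull F i = face_plane i"
  using affine_hull_eq_face_plane F_subset_face_plane polygon_F
  by (simp add: closed_polygon_def)

lemma F_eq_Union_polytopes:
  assumes "i \<in> I"
  obtains Q where "finite Q" "F i = \<Union>Q" "\<And>q. q \<in> Q \<Longrightarrow> polytope q \<and> aff_dim q = 2"
  using polygon_F[OF assms] unfolding closed_polygon_def polytope_def by metis

lemma compact_F:
  assumes "i \<in> I"
  shows "compact (F i)"
proof -
  obtain Q where "finite Q" "F i = \<Union>Q" "\<And>q. q \<in> Q \<Longrightarrow> polytope q \<and> aff_dim q = 2"
    using F_eq_Union_polytopes[OF assms] by metis
  then show ?thesis using polytope_imp_compact by (metis compact_Union)
qed

lemma closed_F: "i \<in> I \<Longrightarrow> closed (F i)"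
  by (simp add: compact_F compact_imp_closed)

lemma rel_interior_subset_rel_interior_F:
  assumes "i \<in> I" "q \<subseteq> F i" "aff_dim q = 2"
  shows "rel_interior q \<subseteq> rel_interior (F i)"
proof (rule subset_rel_interior[OF assms(2)])
  have "affine hull q = face_plane i"
    using affine_hull_eq_face_plane F_subset_face_plane assms by blast
  then show "affine hull q = affine hull F i" using affine_hull_F assms(1) by simp
qed

lemma F_subset_closure_rel_interior:
  assumes "i \<in> I"
  shows "F i \<subseteq> closure (rel_interior (F i))"
proof
  fix x assume "x \<in> F i"
  then obtain q where q: "x \<in> q" "q \<subseteq> F i" "polytope q" "aff_dim q = 2"
    using F_eq_Union_polytopes[OF assms] by (metis UnionE Union_upper)
  have "q \<subseteq> closure (rel_interior q)"
    using q(3) convex_closure_rel_interior closure_subset polytope_imp_convex by metis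
  also have "\<dots> \<subseteq> closure (rel_interior (F i))"
    using rel_interior_subset_rel_interior_F assms q(2,4) by (intro closure_mono)
  finally show "x \<in> closure (rel_interior (F i))" using q(1) by blast
qed

lemma openin_rel_interior_F: "i \<in> I \<Longrightarrow> openin (top_of_set (face_plane i)) (rel_interior (F i))"
  using openin_rel_interior[of "F i"] by (simp add: affine_hull_F)

lemma meeting_faces_transversal:
  assumes "i \<in> I" "k \<in> I" "i \<noteq> k" "rel_interior (F i) \<inter> F k \<noteq> {}"
  shows "\<exists>v. N k \<bullet> v = 0 \<and> N i \<bullet> v \<noteq> 0"
proof (rule ccontr)
  assume no_direction: "\<not> ?thesis"
  obtain x where x: "x \<in> rel_interior (F i)" "x \<in> F k" using assms(4) by blast
  define v where "v = N i - (N k \<bullet> N i) *\<^sub>R N k"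
  have "N k \<bullet> v = 0" using inner_N_self[OF assms(2)] by (simp add: v_def inner_diff_right)
  moreover from this have "N i \<bullet> v = 0" using no_direction by blast
  ultimately have "v \<bullet> v = 0" by (simp add: v_def inner_diff_left)
  then have parallel: "N i = (N k \<bullet> N i) *\<^sub>R N k" by (simp add: v_def)
  have x_planes: "x \<in> face_plane i" "x \<in> face_plane k"
    using x F_subset_face_plane assms rel_interior_subset by blast+
  have planes: "face_plane k \<subseteq> face_plane i"
  proof
    fix y assume "y \<in> face_plane k"
    then have "N k \<bullet> y = N k \<bullet> x" using x_planes(2) by (simp add: face_plane_def)
    then have "N i \<bullet> y = N i \<bullet> x" by (subst (1 2) parallel) simp
    then show "y \<in> face_plane i" using x_planes(1) by (simp add: face_plane_def)
  qed
  obtain U where U: "open U" "rel_interior (F i) = face_plane i \<inter> U"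
    using openin_rel_interior_F[OF assms(1)] by (auto simp: openin_open)
  have "x \<in> U \<inter> closure (rel_interior (F k))"
    using x U F_subset_closure_rel_interior assms(2) by blast
  then obtain z where z: "z \<in> U" "z \<in> rel_interior (F k)"
    using open_Int_closure_eq_empty[OF U(1)] by blast
  then have "z \<in> face_plane i"
    using planes F_subset_face_plane assms(2) rel_interior_subset by blast
  then have "z \<in> rel_interior (F i) \<inter> rel_interior (F k)" using z U(2) by blast
  moreover have "rel_interior (F i) \<inter> rel_interior (F k) = {}"
    using polytop assms(1-3) by (auto simp: polytop_def)
  ultimately show False by blast
qed

lemma segment_covered_F_diff_rel_interior:
  assumes "i \<in> I"
  shows "segment_covered (F i - rel_interior (F i))"
proof -
  obtain Q where Q: "finite Q" "F i = \<Union>Q" "\<And>q. q \<in> Q \<Longrightarrow> polytope q \<and> aff_dim q = 2"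
    using F_eq_Union_polytopes[OF assms] by metis
  have "segment_covered (\<Union>q\<in>Q. rel_frontier q)"
    using Q by (intro segment_covered_UN segment_covered_rel_frontier_polytope) auto
  moreover have "q \<subseteq> rel_frontier q \<union> rel_interior (F i)" if "q \<in> Q" for q
  proof -
    have "rel_interior q \<subseteq> rel_interior (F i)"
      using rel_interior_subset_rel_interior_F[OF assms] Q(2,3) that by (simp add: Union_upper)
    then show ?thesis using closure_subset[of q] unfolding rel_frontier_def by blast
  qed
  then have "F i - rel_interior (F i) \<subseteq> (\<Union>q\<in>Q. rel_frontier q)" using Q(2) by blast
  ultimately show ?thesis by (rule segment_covered_subset)
qed

lemma segment_covered_rel_interior_Int_F:
  assumes "i \<in> I" "k \<in> I" "i \<noteq> k"
  shows "segment_covered (rel_interior (F i) \<inter> F k)"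
proof (cases "rel_interior (F i) \<inter> F k = {}")
  case True
  then show ?thesis by (simp add: segment_covered_subset[OF segment_covered_closed_segment])
next
  case False
  then obtain v where v: "N k \<bullet> v = 0" "N i \<bullet> v \<noteq> 0"
    using meeting_faces_transversal assms by blast
  have "bounded (F i)" using compact_F assms(1) compact_imp_bounded by blast
  then obtain a b where
    "F i \<inter> {x. N i \<bullet> x = offset i} \<inter> {x. N k \<bullet> x = offset k} \<subseteq> closed_segment a b"
    using bounded_transversal_hyperplanes_subset_segment[of "N k" v "N i" "F i"] v
      N_nonzero[OF assms(2)] by fastforce
  moreover have "rel_interior (F i) \<inter> F k \<subseteq> F i \<inter> face_plane i \<inter> face_plane k"
    using F_subset_face_plane[of i] F_subset_face_plane[of k] assms(1,2)
      rel_interior_subset[of "F i"] by blast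
  ultimately have "rel_interior (F i) \<inter> F k \<subseteq> closed_segment a b"
    unfolding face_plane_def by (rule order_trans[rotated])
  then show ?thesis using segment_covered_subset segment_covered_closed_segment by blast
qed

lemma segment_covered_F_diff_face_core: "segment_covered (\<Union>i\<in>I. F i - face_core i)"
proof (rule segment_covered_UN[OF finite_I])
  fix i assume i: "i \<in> I"
  have "segment_covered (\<Union>k\<in>I-{i}. rel_interior (F i) \<inter> F k)"
    using finite_I i by (intro segment_covered_UN segment_covered_rel_interior_Int_F) auto
  then have "segment_covered ((F i - rel_interior (F i)) \<union> (\<Union>k\<in>I-{i}. rel_interior (F i) \<inter> F k))"
    using segment_covered_Un segment_covered_F_diff_rel_interior[OF i] by blast
  then show "segment_covered (F i - face_core i)"
    by (rule segment_covered_subset) (auto simp: face_core_def)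
qed

lemma face_core_subset: "face_core i \<subseteq> F i"
  using rel_interior_subset by (auto simp: face_core_def)

lemma height_face_core: "i \<in> I \<Longrightarrow> x \<in> face_core i \<Longrightarrow> height i x = 0"
  using F_subset_face_plane face_core_subset mem_face_plane by blast

lemma face_core_subset_frontier: "i \<in> I \<Longrightarrow> face_core i \<subseteq> frontier V"
  using face_core_subset frontier_V by blast

lemma face_core_not_interior: "i \<in> I \<Longrightarrow> x \<in> face_core i \<Longrightarrow> x \<notin> interior V"
  using face_core_subset_frontier by (auto simp: frontier_def)

lemma face_core_index_unique: "j \<in> I \<Longrightarrow> x \<in> face_core i \<Longrightarrow> x \<in> F j \<Longrightarrow> i = j"
  by (auto simp: face_core_def)

lemma eventually_face_core_iff:
  assumes i: "i \<in> I" and x: "x \<in> face_core i"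
  shows "\<forall>\<^sub>F y in nhds x. y \<in> face_core i \<longleftrightarrow> height i y = 0"
    and "\<forall>\<^sub>F y in nhds x. y \<in> frontier V \<longleftrightarrow> height i y = 0"
proof -
  obtain U where U: "open U" "rel_interior (F i) = face_plane i \<inter> U"
    using openin_rel_interior_F[OF i] by (auto simp: openin_open)
  let ?U = "U \<inter> - (\<Union>k\<in>I-{i}. F k)"
  have "open ?U" using U(1) finite_I closed_F by (intro open_Int open_Compl closed_UN) auto
  moreover have "x \<in> ?U" using x U(2) by (auto simp: face_core_def)
  ultimately have near: "\<forall>\<^sub>F y in nhds x. y \<in> ?U" by (rule eventually_nhds_in_open)
  have core: "y \<in> face_core i \<longleftrightarrow> height i y = 0" if "y \<in> ?U" for y
    using that U(2) by (auto simp: face_core_def mem_face_plane)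
  have "y \<in> frontier V \<longleftrightarrow> height i y = 0" if "y \<in> ?U" for y
    using that core[OF that] frontier_V face_core_subset_frontier[OF i] F_subset_face_plane[OF i]
      mem_face_plane by blast
  then show "\<forall>\<^sub>F y in nhds x. y \<in> frontier V \<longleftrightarrow> height i y = 0"
    using near by (rule eventually_mono[rotated])
  show "\<forall>\<^sub>F y in nhds x. y \<in> face_core i \<longleftrightarrow> height i y = 0"
    using near core by (rule eventually_mono)
qed

lemma eventually_interior_iff_height_pos:
  assumes i: "i \<in> I" and x: "x \<in> face_core i"
  shows "\<forall>\<^sub>F y in nhds x. y \<in> interior V \<longleftrightarrow> 0 < height i y"
proof -
  obtain e where e: "e > 0" "\<And>y. y \<in> ball x e \<Longrightarrow> y \<in> frontier V \<longleftrightarrow> height i y = 0"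
    using eventually_face_core_iff(2)[OF i x]
    by (auto simp: eventually_nhds_metric dist_commute)
  have "\<forall>x\<in>face_core i. \<exists>d>0. \<forall>t. 0 < t \<and> t < d \<longrightarrow>
      x + t *\<^sub>R N i \<in> interior V \<and> x - t *\<^sub>R N i \<notin> V"
    using polytop i unfolding polytop_def face_core_def by blast
  then obtain d where d: "d > 0"
    "\<And>t. 0 < t \<Longrightarrow> t < d \<Longrightarrow> x + t *\<^sub>R N i \<in> interior V \<and> x - t *\<^sub>R N i \<notin> V"
    using x by blast
  define t where "t = min e d / 2"
  have t: "0 < t" "t < e" "t < d" using e(1) d(1) by (auto simp: t_def)
  let ?up = "ball x e \<inter> {y. offset i < N i \<bullet> y}" and ?down = "ball x e \<inter> {y. N i \<bullet> y < offset i}"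
  have x_on_plane: "N i \<bullet> x = offset i" using height_face_core[OF i x] by (simp add: height_def)
  have "connected ?up" "connected ?down"
    by (intro convex_connected convex_Int convex_ball convex_halfspace_gt convex_halfspace_lt)+
  moreover have "?up \<inter> frontier V = {}" "?down \<inter> frontier V = {}"
    using e(2) by (auto simp: height_def)
  moreover have "x + t *\<^sub>R N i \<in> ?up" "x - t *\<^sub>R N i \<in> ?down"
    using t x_on_plane norm_N[OF i] inner_N_self[OF i]
    by (simp_all add: dist_norm inner_add_right inner_diff_right)
  ultimately have "?up \<subseteq> interior V" "?down \<inter> V = {}"
    using connected_disjoint_frontier_cases[of _ V] d(2)[OF t(1,3)] interior_subset by blast+
  then have "y \<in> interior V \<longleftrightarrow> 0 < height i y" if "y \<in> ball x e" for y
  proof (cases "height i y" "0 :: real" rule: linorder_cases)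
    case equal
    then have "y \<in> frontier V" using e(2) that by blast
    then show ?thesis using equal by (simp add: frontier_def)
  qed (use that interior_subset[of V] in \<open>auto simp: height_def\<close>)
  then show ?thesis
    unfolding eventually_nhds_metric using e(1) by (auto simp: dist_commute)
qed

definition orbit :: "pt set \<Rightarrow> pt set" where
  "orbit X = (\<Union>g\<in>refl_group I N. g ` X)"

lemma orbit_superset: "X \<subseteq> orbit X"
  using UN_upper[OF refl_group_id, of "\<lambda>g. g ` X"] by (simp add: orbit_def)

lemma reflect_in_orbit:
  assumes "x \<in> orbit X" "i \<in> I"
  shows "reflect (N i) x \<in> orbit X"
proof -
  obtain g y where g: "g \<in> refl_group I N" "y \<in> X" "x = g y"
    using assms(1) by (auto simp: orbit_def)
  have "(reflect (N i) \<circ> g) y \<in> orbit X"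
    unfolding orbit_def using refl_group_step[OF g(1) assms(2)] g(2) by blast
  then show ?thesis using g(3) by simp
qed

lemma norm_refl_group: "g \<in> refl_group I N \<Longrightarrow> norm (g x) = norm x"
  by (induction rule: refl_group.induct) (simp_all add: norm_reflect norm_N)

lemma zero_in_orbit_iff: "0 \<in> orbit X \<longleftrightarrow> 0 \<in> X"
proof
  assume "0 \<in> orbit X"
  then obtain g x where "g \<in> refl_group I N" "x \<in> X" "g x = 0" by (auto simp: orbit_def)
  then show "0 \<in> X" using norm_refl_group by (metis norm_eq_zero)
qed (use orbit_superset in blast)

section \<open>Chords\<close>

definition chord :: "pt \<Rightarrow> pt \<Rightarrow> pt \<Rightarrow> bool" where
  "chord v x y \<longleftrightarrow> x \<notin> interior V \<and> y \<notin> interior V \<and>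
     (\<exists>t>0. y = x + t *\<^sub>R v \<and> (\<forall>s. 0 < s \<and> s < t \<longrightarrow> x + s *\<^sub>R v \<in> interior V))"

lemma chordE:
  assumes "chord v x y"
  obtains t where "t > 0" "y = x + t *\<^sub>R v" "\<And>s. 0 < s \<Longrightarrow> s < t \<Longrightarrow> x + s *\<^sub>R v \<in> interior V"
  using assms by (auto simp: chord_def)

lemma chord_interior:
  assumes "chord v x (x + t *\<^sub>R v)" "0 < \<sigma>" "\<sigma> < 1"
  shows "x + (\<sigma> * t) *\<^sub>R v \<in> interior V"
proof -
  obtain t' where t': "t' > 0" "x + t *\<^sub>R v = x + t' *\<^sub>R v"
    "\<And>s. 0 < s \<Longrightarrow> s < t' \<Longrightarrow> x + s *\<^sub>R v \<in> interior V"
    using assms(1) by (metis chordE)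
  have "(\<sigma> * t) *\<^sub>R v = (\<sigma> * t') *\<^sub>R v" using t'(2) by (metis add_left_cancel scaleR_scaleR)
  moreover have "x + (\<sigma> * t') *\<^sub>R v \<in> interior V" using t'(1,3) assms(2,3) by simp
  ultimately show ?thesis by (simp only:)
qed

lemma hit_point_eq_chord_end:
  assumes "chord v x y"
  shows "hit_point V x v = y"
proof -
  obtain t where t: "t > 0" "y = x + t *\<^sub>R v" "\<And>s. 0 < s \<Longrightarrow> s < t \<Longrightarrow> x + s *\<^sub>R v \<in> interior V"
    using assms by (metis chordE)
  have y: "y \<notin> interior V" using assms by (simp add: chord_def)
  have "Inf {s. s > 0 \<and> x + s *\<^sub>R v \<notin> interior V} = t"
    by (rule cInf_eq_minimum) (use t y in \<open>auto simp: not_less[symmetric]\<close>)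
  then show ?thesis using t by (simp add: hit_point_def exit_time_def)
qed

lemma chord_reverse:
  assumes "chord v x y"
  shows "chord (- v) y x"
proof -
  obtain t where t: "t > 0" "y = x + t *\<^sub>R v" "\<And>s. 0 < s \<Longrightarrow> s < t \<Longrightarrow> x + s *\<^sub>R v \<in> interior V"
    using assms by (metis chordE)
  have "y + s *\<^sub>R (- v) \<in> interior V" if "0 < s" "s < t" for s
    using t(3)[of "t - s"] that t(2) by (simp add: algebra_simps)
  moreover have "x = y + t *\<^sub>R (- v)" using t(2) by simp
  ultimately show ?thesis using assms t(1) unfolding chord_def by blast
qed

lemma eventually_at_right_interior_iff:
  assumes i: "i \<in> I" "x \<in> face_core i"
  shows "\<forall>\<^sub>F s in at_right 0. x + s *\<^sub>R v \<in> interior V \<longleftrightarrow> 0 < N i \<bullet> v"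
proof -
  have "((\<lambda>s. x + s *\<^sub>R v) \<longlongrightarrow> x + 0 *\<^sub>R v) (at_right 0)" by (intro tendsto_intros)
  then have "((\<lambda>s. x + s *\<^sub>R v) \<longlongrightarrow> x) (at_right 0)" by simp
  then have "\<forall>\<^sub>F s in at_right 0. x + s *\<^sub>R v \<in> interior V \<longleftrightarrow> 0 < height i (x + s *\<^sub>R v)"
    using eventually_interior_iff_height_pos[OF i] by (rule eventually_compose_filterlim[rotated])
  then show ?thesis
    using eventually_at_right_less[of "0 :: real"]
    by eventually_elim (simp add: height_add height_face_core[OF i] zero_less_mult_iff)
qed

lemma chord_departs_upwards:
  assumes "chord v x y" and i: "i \<in> I" "x \<in> face_core i"
  shows "0 < N i \<bullet> v"
proof -
  obtain t where t: "t > 0" "\<And>s. 0 < s \<Longrightarrow> s < t \<Longrightarrow> x + s *\<^sub>R v \<in> interior V"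
    using assms(1) by (metis chordE)
  have "\<forall>\<^sub>F s in at_right 0. s \<in> {0<..<t}" using t(1) by (rule eventually_at_right_real)
  then have "\<forall>\<^sub>F s in at_right (0 :: real). 0 < N i \<bullet> v"
    using eventually_at_right_interior_iff[OF i, of v] by eventually_elim (use t(2) in simp)
  then show ?thesis by simp
qed

lemma chord_arrives_downwards:
  assumes "chord v x y" "j \<in> I" "y \<in> face_core j"
  shows "N j \<bullet> v < 0"
  using chord_departs_upwards[OF chord_reverse[OF assms(1)] assms(2,3)] by simp

lemma chord_exists:
  assumes i: "i \<in> I" "x \<in> face_core i" and v: "0 < N i \<bullet> v"
  shows "\<exists>y\<in>frontier V. chord v x y"
proof -
  have "\<forall>\<^sub>F s in at_right 0. x + s *\<^sub>R v \<in> interior V"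
    using eventually_at_right_interior_iff[OF i, of v] v by simp
  then obtain b where b: "b > 0" "\<And>s. 0 < s \<Longrightarrow> s < b \<Longrightarrow> x + s *\<^sub>R v \<in> interior V"
    by (auto simp: eventually_at_right_field)
  define a where "a = b / 2"
  have a: "0 < a" "a < b" using b(1) by (simp_all add: a_def)
  have "v \<noteq> 0" using v by auto
  then obtain d where d: "d > 0" "x + a *\<^sub>R v + d *\<^sub>R v \<in> frontier V"
    "\<And>s. 0 \<le> s \<Longrightarrow> s < d \<Longrightarrow> x + a *\<^sub>R v + s *\<^sub>R v \<in> interior V"
    using ray_to_frontier[OF compact_imp_bounded[OF compact_V] b(2)[OF a]] by blast
  let ?y = "x + (a + d) *\<^sub>R v"
  have y: "?y \<in> frontier V" using d(2) by (simp add: algebra_simps)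
  have "x + s *\<^sub>R v \<in> interior V" if "0 < s" "s < a + d" for s
    using b(2)[of s] d(3)[of "s - a"] that a by (cases "s < a") (simp_all add: algebra_simps)
  moreover have "0 < a + d" using a(1) d(1) by simp
  ultimately have "chord v x ?y"
    using y face_core_not_interior[OF i] unfolding chord_def frontier_def by blast
  then show ?thesis using y by blast
qed

definition flight_time :: "'i \<Rightarrow> pt \<Rightarrow> pt \<Rightarrow> real" where
  "flight_time j v x = - height j x / (N j \<bullet> v)"

text \<open>The shear agrees on the plane of face \<open>i\<close> with the projection along \<open>v\<close> onto the plane of
  face \<open>j\<close>; the first summand of the coefficient makes it an affine bijection of the whole space.\<close>

definition shear :: "'i \<Rightarrow> 'i \<Rightarrow> pt \<Rightarrow> pt \<Rightarrow> pt" where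
  "shear i j v x = x + (height i x / (N i \<bullet> v) + flight_time j v x) *\<^sub>R v"

lemma shear_on_face_plane: "height i x = 0 \<Longrightarrow> shear i j v x = x + flight_time j v x *\<^sub>R v"
  by (simp add: shear_def)

lemma shear_minus: "shear i j (- v) = shear i j v"
  by (simp add: shear_def flight_time_def fun_eq_iff algebra_simps)

lemma height_shear:
  assumes "N j \<bullet> v \<noteq> 0" "height i x = 0"
  shows "height j (shear i j v x) = 0"
  using assms by (simp add: shear_on_face_plane height_diff flight_time_def)

lemma shear_inverse:
  assumes "N i \<bullet> v \<noteq> 0" "N j \<bullet> v \<noteq> 0"
  shows "shear j i v (shear i j v x) = x"
proof -
  define c where "c = height i x / (N i \<bullet> v) + flight_time j v x"
  have "height j (x + c *\<^sub>R v) / (N j \<bullet> v) + flight_time i v (x + c *\<^sub>R v) = - c"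
    using assms
    by (simp add: height_add add_divide_distrib diff_divide_distrib flight_time_def c_def)
  then show ?thesis by (simp add: shear_def flip: c_def)
qed

lemma inner_shear: "w \<bullet> v = 0 \<Longrightarrow> w \<bullet> shear i j v x = w \<bullet> x"
  by (simp add: shear_def inner_add_right)

lemma isCont_flight_time: "isCont (flight_time j v) x"
  unfolding flight_time_def divide_inverse by (intro continuous_intros)

lemma isCont_shear: "isCont (shear i j v) x"
  unfolding shear_def divide_inverse by (intro continuous_intros isCont_flight_time)

lemma continuous_on_shear: "continuous_on X (shear i j v)"
  using isCont_shear by (simp add: continuous_at_imp_continuous_on)

lemma shear_closed_segment:
  "shear i j v ` closed_segment x y = closed_segment (shear i j v x) (shear i j v y)"
proof -
  have "shear i j v ((1 - u) *\<^sub>R x + u *\<^sub>R y) = (1 - u) *\<^sub>R shear i j v x + u *\<^sub>R shear i j v y" for u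
    by (simp add: shear_def flight_time_def height_def inner_add_right algebra_simps
        diff_divide_distrib add_divide_distrib)
  then show ?thesis unfolding closed_segment_def by (auto simp: image_iff) metis+
qed

lemma smooth_on_shear_fst: "smooth_on UNIV (\<lambda>p::phase. (shear i j v (fst p), u::pt))"
proof -
  let ?L = "\<lambda>p::phase.
    (fst p + ((N i \<bullet> fst p) / (N i \<bullet> v) - (N j \<bullet> fst p) / (N j \<bullet> v)) *\<^sub>R v, 0::pt)"
  have "linear ?L"
    by (rule linearI) (auto simp: inner_add_right algebra_simps add_divide_distrib)
  then have "bounded_linear ?L" by (simp add: linear_conv_bounded_linear)
  from smooth_on_affine[OF this, of "((offset j / (N j \<bullet> v) - offset i / (N i \<bullet> v)) *\<^sub>R v, u)"]
  show ?thesis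
    by (simp add: shear_def flight_time_def height_def algebra_simps diff_divide_distrib)
qed

lemma chord_end_eq_shear:
  assumes "i \<in> I" "j \<in> I" "chord v x y" "x \<in> face_core i" "y \<in> face_core j"
  shows "y = shear i j v x"
proof -
  obtain t where t: "y = x + t *\<^sub>R v" using assms(3) by (rule chordE)
  have "N j \<bullet> v \<noteq> 0" using chord_arrives_downwards assms by force
  moreover have "height j x + t * (N j \<bullet> v) = 0"
    using height_face_core[of j y] assms t by (simp add: height_add)
  ultimately have "t = flight_time j v x" by (simp add: flight_time_def field_simps)
  then show ?thesis using height_face_core assms(1,4) t by (simp add: shear_on_face_plane)
qed

section \<open>Transit regions\<close>

definition transit :: "'i \<Rightarrow> 'i \<Rightarrow> pt \<Rightarrow> pt set" where
  "transit i j v = {x. i \<in> I \<and> j \<in> I \<and> x \<in> face_core i \<and> (\<exists>y\<in>face_core j. chord v x y)}"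

lemma transitI:
  assumes "i \<in> I" "j \<in> I" "x \<in> face_core i" "y \<in> face_core j" "chord v x y"
  shows "x \<in> transit i j v"
  using assms by (auto simp: transit_def)

lemma transitD:
  assumes "x \<in> transit i j v"
  shows "i \<in> I" "j \<in> I" "x \<in> face_core i" "shear i j v x \<in> face_core j"
    "chord v x (shear i j v x)" "0 < N i \<bullet> v" "N j \<bullet> v < 0"
  using assms chord_end_eq_shear[of i j v x] chord_departs_upwards[of v x]
    chord_arrives_downwards[of v x]
  by (auto simp: transit_def)

lemma transit_subset_face_plane: "transit i j v \<subseteq> face_plane i"
  using transitD(1,3) height_face_core mem_face_plane by blast

lemma transit_subset_F: "transit i j v \<subseteq> F i"
  using transitD(3) face_core_subset by blast

lemma transit_disjoint:
  assumes "x \<in> transit i j v" "x \<in> transit i' j' v"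
  shows "i = i'" "j = j'"
proof -
  note flight = transitD[OF assms(1)] and flight' = transitD[OF assms(2)]
  show "i = i'" using flight(3) flight'(1,3) face_core_subset face_core_index_unique by blast
  have "shear i j v x = shear i' j' v x" using flight(5) flight'(5) hit_point_eq_chord_end by metis
  then show "j = j'"
    using flight(4) flight'(2,4) face_core_subset face_core_index_unique by (metis subsetD)
qed

lemma eventually_flight_time_pos:
  assumes x: "x \<in> transit i j v"
  shows "\<forall>\<^sub>F z in nhds x. 0 < flight_time j v z"
proof -
  obtain t where "t > 0" "shear i j v x = x + t *\<^sub>R v" using transitD(5)[OF x] by (rule chordE)
  moreover have "v \<noteq> 0" using transitD(6)[OF x] by auto
  ultimately have "0 < flight_time j v x"
    using height_face_core transitD(1,3)[OF x] by (simp add: shear_on_face_plane)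
  then have "\<forall>\<^sub>F y in nhds (flight_time j v x). 0 < y"
    using eventually_nhds_in_open[OF open_greaterThan] by simp
  then show ?thesis using isCont_flight_time by (rule eventually_nhds_isCont[rotated])
qed

definition flight :: "'i \<Rightarrow> pt \<Rightarrow> pt \<times> real \<Rightarrow> pt" where
  "flight j v = (\<lambda>(z, \<sigma>). z + (\<sigma> * flight_time j v z) *\<^sub>R v)"

lemma height_flight:
  "height i (flight j v p) = height i (fst p) + snd p * flight_time j v (fst p) * (N i \<bullet> v)"
  by (simp add: flight_def case_prod_unfold height_add)

lemma height_flight_target:
  "N j \<bullet> v \<noteq> 0 \<Longrightarrow>
    height j (flight j v p) = (1 - snd p) * flight_time j v (fst p) * - (N j \<bullet> v)"
  by (simp add: height_flight flight_time_def field_simps)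

lemma isCont_flight: "isCont (flight j v) p"
  unfolding flight_def case_prod_unfold
  by (intro continuous_intros isCont_o2[OF _ isCont_flight_time])

text \<open>The chord from a nearby point is interior near both ends by the signs of the heights, and in
  between because the interior is open; compactness of \<open>[0, 1]\<close> makes this uniform.\<close>

lemma eventually_flight_interior_at:
  assumes x: "x \<in> transit i j v" and \<sigma>: "\<sigma> \<in> {0..1}"
  shows "\<forall>\<^sub>F p in nhds (x, \<sigma>).
    height i (fst p) = 0 \<longrightarrow> snd p \<in> {0<..<1} \<longrightarrow> flight j v p \<in> interior V"
proof -
  note flight = transitD[OF x]
  have at_start: "flight j v (x, 0) = x" and at_end: "flight j v (x, 1) = shear i j v x"
    using height_face_core[OF flight(1,3)] by (simp_all add: shear_on_face_plane flight_def)
  have time_pos: "\<forall>\<^sub>F p in nhds (x, \<sigma>). 0 < flight_time j v (fst p)"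
    using eventually_flight_time_pos[OF x]
    by (intro eventually_nhds_isCont[where f = fst and P = "\<lambda>z. 0 < flight_time j v z"])
      (auto intro: continuous_intros)
  consider (start) "\<sigma> = 0" | (landing) "\<sigma> = 1" | (between) "0 < \<sigma>" "\<sigma> < 1" using \<sigma> by fastforce
  then show ?thesis
  proof cases
    case start
    then have "\<forall>\<^sub>F y in nhds (flight j v (x, \<sigma>)). y \<in> interior V \<longleftrightarrow> 0 < height i y"
      using eventually_interior_iff_height_pos[OF flight(1,3)] at_start by simp
    from eventually_nhds_isCont[OF isCont_flight this] time_pos show ?thesis
      by eventually_elim (use flight(6) height_flight in auto)
  next
    case landing
    then have "\<forall>\<^sub>F y in nhds (flight j v (x, \<sigma>)). y \<in> interior V \<longleftrightarrow> 0 < height j y"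
      using eventually_interior_iff_height_pos[OF flight(2,4)]
        at_end by simp
    from eventually_nhds_isCont[OF isCont_flight this] time_pos show ?thesis
      by eventually_elim (use flight(7) height_flight_target in \<open>auto simp: mult_pos_neg\<close>)
  next
    case between
    have "chord v x (x + flight_time j v x *\<^sub>R v)"
      using flight(5) at_end by (simp add: flight_def)
    then have "flight j v (x, \<sigma>) \<in> interior V"
      using chord_interior between by (simp add: flight_def)
    from eventually_nhds_isCont[OF isCont_flight eventually_nhds_in_open[OF open_interior this]]
    show ?thesis by eventually_elim simp
  qed
qed

lemma eventually_flight_interior:
  assumes "x \<in> transit i j v"
  shows "\<forall>\<^sub>F z in nhds x. height i z = 0 \<longrightarrow> (\<forall>\<sigma>\<in>{0<..<1}. flight j v (z, \<sigma>) \<in> interior V)"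
  using eventually_nhds_ball_compact[OF compact_Icc eventually_flight_interior_at[OF assms]]
  by (rule eventually_mono) auto

lemma eventually_transit:
  assumes x: "x \<in> transit i j v"
  shows "\<forall>\<^sub>F z in nhds x. height i z = 0 \<longrightarrow> z \<in> transit i j v"
proof -
  note flight = transitD[OF x]
  have "\<forall>\<^sub>F z in nhds x. shear i j v z \<in> face_core j \<longleftrightarrow> height j (shear i j v z) = 0"
    using isCont_shear eventually_face_core_iff(1)[OF flight(2,4)] by (rule eventually_nhds_isCont)
  then show ?thesis
    using eventually_face_core_iff(1)[OF flight(1,3)] eventually_flight_time_pos[OF x]
      eventually_flight_interior[OF x]
  proof eventually_elim
    case (elim z)
    show ?case
    proof
      assume z: "height i z = 0"
      let ?t = "flight_time j v z"
      have ends: "shear i j v z \<in> face_core j" "z \<in> face_core i"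
        using elim(1,2) z height_shear flight(7) by auto
      then have outside: "z \<notin> interior V" "shear i j v z \<notin> interior V"
        using flight(1,2) face_core_not_interior by blast+
      have "z + s *\<^sub>R v \<in> interior V" if "0 < s" "s < ?t" for s
      proof -
        have "s / ?t \<in> {0<..<1}" using that by simp
        then have "flight j v (z, s / ?t) \<in> interior V" using elim(4) z by blast
        then show ?thesis using elim(3) by (simp add: flight_def)
      qed
      then have "chord v z (shear i j v z)"
        using outside elim(3) shear_on_face_plane[OF z] unfolding chord_def by blast
      then show "z \<in> transit i j v" using transitI flight(1,2) ends by blast
    qed
  qed
qed

lemma openin_transit:
  shows "openin (top_of_set (face_plane i)) (transit i j v)"
    and "openin (top_of_set (frontier V)) (transit i j v)"
proof -
  show "openin (top_of_set (face_plane i)) (transit i j v)"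
    using eventually_transit transit_subset_face_plane
    by (simp add: openin_iff_eventually_nhds mem_face_plane)
  have "\<forall>\<^sub>F z in nhds x. z \<in> frontier V \<longrightarrow> z \<in> transit i j v" if "x \<in> transit i j v" for x
    using eventually_transit[OF that] eventually_face_core_iff(2)[OF transitD(1,3)[OF that]]
    by eventually_elim simp
  then show "openin (top_of_set (frontier V)) (transit i j v)"
    using transitD(1,3) face_core_subset_frontier unfolding openin_iff_eventually_nhds by blast
qed

lemma homeomorphism_shear_transit:
  assumes "transit i j v \<noteq> {}"
  shows "homeomorphism (transit i j v) (transit j i (- v)) (shear i j v) (shear j i v)"
proof (rule homeomorphismI)
  have transversal: "N i \<bullet> v \<noteq> 0" "N j \<bullet> v \<noteq> 0" using assms transitD(6,7) by fastforce+
  show "shear j i v (shear i j v x) = x" "shear i j v (shear j i v x) = x" for x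
    using shear_inverse transversal by blast+
  have "shear k l u ` transit k l u \<subseteq> transit l k (- u)" for k l u
  proof (rule image_subsetI)
    fix x assume "x \<in> transit k l u"
    note flight = transitD[OF this]
    show "shear k l u x \<in> transit l k (- u)"
      using chord_reverse[OF flight(5)] by (rule transitI[OF flight(2,1,4,3)])
  qed
  from this[of i j v] this[of j i "- v"]
  show "shear i j v ` transit i j v \<subseteq> transit j i (- v)"
    "shear j i v ` transit j i (- v) \<subseteq> transit i j v" by (simp_all add: shear_minus)
qed (rule continuous_on_shear)+

definition edge_planes :: "pt \<Rightarrow> (pt \<times> real) set" where
  "edge_planes v = (SOME K. parallel_planes v K \<and> (\<Union>i\<in>I. F i - face_core i) \<subseteq> planes_Union K)"

lemma parallel_edge_planes: "parallel_planes v (edge_planes v)"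
  and F_diff_edge_planes_subset: "i \<in> I \<Longrightarrow> F i - planes_Union (edge_planes v) \<subseteq> face_core i"
proof -
  have "\<exists>K. parallel_planes v K \<and> (\<Union>i\<in>I. F i - face_core i) \<subseteq> planes_Union K"
    by (intro segment_covered_subset_parallel_planes segment_covered_F_diff_face_core) simp
  then have edge_planes: "parallel_planes v (edge_planes v) \<and>
      (\<Union>i\<in>I. F i - face_core i) \<subseteq> planes_Union (edge_planes v)"
    unfolding edge_planes_def by (rule someI_ex)
  then show "parallel_planes v (edge_planes v)" ..
  show "i \<in> I \<Longrightarrow> F i - planes_Union (edge_planes v) \<subseteq> face_core i"
    using edge_planes by blast
qed

text \<open>Planes parallel to \<open>v\<close> are unions of lines in direction \<open>v\<close>, so a chord that ends on an edge
  starts on one of the \<open>edge_planes\<close>.\<close>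

lemma F_diff_edge_planes_subset_transit:
  assumes "i \<in> I" "0 < N i \<bullet> v"
  shows "F i - planes_Union (edge_planes v) \<subseteq> (\<Union>j. transit i j v)"
proof
  fix x assume x: "x \<in> F i - planes_Union (edge_planes v)"
  have core: "x \<in> face_core i" using F_diff_edge_planes_subset[OF assms(1)] x by blast
  then obtain y where y: "y \<in> frontier V" "chord v x y" using chord_exists assms by blast
  then obtain j where j: "j \<in> I" "y \<in> F j" using frontier_V by blast
  obtain t where "y = x + t *\<^sub>R v" using y(2) by (rule chordE)
  then have "y \<notin> planes_Union (edge_planes v)"
    using planes_Union_translate[OF parallel_edge_planes] x by blast
  then have "y \<in> face_core j" using F_diff_edge_planes_subset j by blast
  then have "x \<in> transit i j v" using transitI assms(1) j(1) core y(2) by blast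
  then show "x \<in> (\<Union>j. transit i j v)" by blast
qed

lemma F_subset_closure_transit:
  assumes "i \<in> I" "0 < N i \<bullet> v"
  shows "F i \<subseteq> closure (\<Union>j. transit i j v)"
proof -
  have "rel_interior (F i) \<subseteq> closure (rel_interior (F i) - planes_Union (edge_planes v))"
    using openin_hyperplane_subset_closure_diff_planes[OF _ _ parallel_edge_planes,
        of "N i" "offset i"]
      openin_rel_interior_F[OF assms(1)] assms(2) by (simp add: face_plane_def)
  also have "\<dots> \<subseteq> closure (\<Union>j. transit i j v)"
    using F_diff_edge_planes_subset_transit[OF assms] rel_interior_subset[of "F i"]
    by (intro closure_mono) blast
  finally show ?thesis
    using F_subset_closure_rel_interior[OF assms(1)] closure_minimal[OF _ closed_closure] by blast
qed

lemma connected_subset_transit: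
  assumes "connected C" "C \<subseteq> (\<Union>k. transit i k v)" "C \<inter> transit i j v \<noteq> {}"
  shows "C \<subseteq> transit i j v"
proof (rule connected_subset_disjoint_open_member)
  let ?\<D> = "range (\<lambda>k. transit i k v)"
  show "connected C" "C \<subseteq> \<Union>?\<D>" "transit i j v \<in> ?\<D>" "C \<inter> transit i j v \<noteq> {}"
    using assms by auto
  show "pairwise disjnt ?\<D>"
    using transit_disjoint(2) unfolding pairwise_def disjnt_iff by blast
  show "openin (top_of_set (\<Union>?\<D>)) E" if "E \<in> ?\<D>" for E
  proof -
    obtain k where "E = transit i k v" using \<open>E \<in> ?\<D>\<close> by blast
    moreover have "\<Union>?\<D> \<subseteq> face_plane i" using transit_subset_face_plane by blast
    ultimately show ?thesis
      using openin_subset_trans[OF openin_transit(1), of i k v "\<Union>?\<D>"] by blast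
  qed
qed

lemma openin_component_transit:
  assumes "P \<in> components (transit i j v)"
  shows "openin (top_of_set (face_plane i)) P"
proof -
  have "locally connected (face_plane i)"
    unfolding face_plane_def by (rule convex_imp_locally_connected[OF convex_hyperplane])
  then show ?thesis
    using assms openin_transit(1) unfolding locally_connected_open_component by blast
qed

lemma closure_diff_component_transit_subset:
  assumes P: "P \<in> components (transit i j v)"
  shows "closure P - P \<subseteq> planes_Union (edge_planes v)"
proof
  fix x assume x: "x \<in> closure P - P"
  have P_subset: "P \<subseteq> transit i j v"
    using P by (rule in_components_subset)
  then obtain z where "z \<in> transit i j v" using in_components_nonempty[OF P] by blast
  then have i: "i \<in> I" "0 < N i \<bullet> v" by (rule transitD)+
  show "x \<in> planes_Union (edge_planes v)"
  proof (rule ccontr)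
    assume "x \<notin> planes_Union (edge_planes v)"
    moreover have "closure P \<subseteq> F i"
      using P_subset transit_subset_F closed_F[OF i(1)] by (intro closure_minimal) blast+
    ultimately obtain k where k: "x \<in> transit i k v"
      using F_diff_edge_planes_subset_transit[OF i] x by blast
    obtain U where U: "open U" "transit i k v = face_plane i \<inter> U"
      using openin_transit(1)[of i k v] by (auto simp: openin_open)
    then obtain z where z: "z \<in> U" "z \<in> P" using x k open_Int_closure_eq_empty[of U P] by blast
    then have "z \<in> transit i k v" using U(2) P_subset transit_subset_face_plane by blast
    then have "j = k" using transit_disjoint(2) z(2) P_subset by blast
    then have "x \<in> transit i j v \<inter> closure P" using k x by blast
    then show False using closedin_imp_eq_Int_closure[OF closedin_component[OF P]] x by blast
  qed
qed

lemma open_polygon_component_transit: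
  assumes P: "P \<in> components (transit i j v)"
  shows "open_polygon (P \<times> {u})"
proof -
  have P_subset: "P \<subseteq> transit i j v" and P_nonempty: "P \<noteq> {}"
    using P in_components_subset in_components_nonempty by blast+
  then obtain x where "x \<in> transit i j v" by blast
  then have i: "i \<in> I" "0 < N i \<bullet> v" by (rule transitD)+
  have "bounded (F i)" using compact_F[OF i(1)] by (rule compact_imp_bounded)
  then have "bounded P" using P_subset transit_subset_F by (meson bounded_subset order_trans)
  then show ?thesis
    using open_polygon_Times_singleton[OF P_nonempty _ _ _ parallel_edge_planes,
        of "N i" "offset i" v]
      openin_component_transit[OF P] closure_diff_component_transit_subset[OF P] i(2)
    by (simp add: face_plane_def)
qed

lemma transit_same_cell_connected:
  assumes xy: "x \<in> transit i j v" "y \<in> transit i j v"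
    and off: "x \<notin> planes_Union (edge_planes v)" "y \<notin> planes_Union (edge_planes v)"
    and below: "planes_below (edge_planes v) x = planes_below (edge_planes v) y"
  shows "connected_component (transit i j v) x y"
proof -
  let ?C = "closed_segment x y"
  note flight = transitD[OF xy(1)]
  have disjoint: "?C \<inter> planes_Union (edge_planes v) = {}"
    using closed_segment_disjoint_planes_Union[OF off below] .
  have "?C \<subseteq> rel_interior (F i)"
  proof (rule connected_subset_rel_interior)
    show "?C \<subseteq> affine hull F i"
      using xy transit_subset_face_plane unfolding affine_hull_F[OF flight(1)] face_plane_def
      by (intro closed_segment_subset convex_hyperplane) blast+
    show "?C \<inter> rel_interior (F i) \<noteq> {}" using flight(3) by (auto simp: face_core_def)
    have "rel_frontier (F i) \<subseteq> F i - face_core i"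
      using closed_F[OF flight(1)] by (auto simp: rel_frontier_def face_core_def)
    then show "?C \<inter> rel_frontier (F i) = {}"
      using F_diff_edge_planes_subset[OF flight(1), of v] disjoint by blast
  qed simp
  then have "?C \<subseteq> (\<Union>k. transit i k v)"
    using F_diff_edge_planes_subset_transit[OF flight(1,6)] disjoint rel_interior_subset[of "F i"]
    by blast
  moreover have "?C \<inter> transit i j v \<noteq> {}" using xy(1) by auto
  ultimately have "?C \<subseteq> transit i j v" by (intro connected_subset_transit) simp_all
  then show ?thesis unfolding connected_component_def by (intro exI[of _ ?C]) auto
qed

lemma finite_components_transit: "finite (components (transit i j v))"
proof (cases "transit i j v = {}")
  case False
  then have transversal: "N i \<bullet> v \<noteq> 0" using transitD(6) by fastforce
  let ?K = "edge_planes v" and ?cc = "connected_component_set (transit i j v)"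
  have "components (transit i j v) \<subseteq> ?cc ` (transit i j v - planes_Union ?K)"
  proof
    fix P assume P: "P \<in> components (transit i j v)"
    have "P \<subseteq> closure (P - planes_Union ?K)"
      using openin_hyperplane_subset_closure_diff_planes[OF _ transversal parallel_edge_planes]
        openin_component_transit[OF P] by (simp add: face_plane_def)
    then obtain x where x: "x \<in> P" "x \<notin> planes_Union ?K"
      using in_components_nonempty[OF P] closure_empty
      by (metis Diff_eq_empty_iff subsetI subset_empty)
    then have "P = ?cc x" using P by (metis componentsE connected_component_eq)
    then show "P \<in> ?cc ` (transit i j v - planes_Union ?K)"
      using x in_components_subset[OF P] by blast
  qed
  moreover have "planes_below ?K ` (transit i j v - planes_Union ?K) \<subseteq> Pow ?K"
    by (auto simp: planes_below_def)
  then have "finite (planes_below ?K ` (transit i j v - planes_Union ?K))"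
    using parallel_edge_planes by (meson finite_Pow_iff finite_subset parallel_planes_def)
  then have "finite (?cc ` (transit i j v - planes_Union ?K))"
    by (rule card_image_le_card_image(1))
      (use transit_same_cell_connected connected_component_eq in blast)
  ultimately show ?thesis by (rule finite_subset)
qed simp

end

section \<open>The directional billiard map\<close>

locale rational_billiard = polytop_billiard V I F N
  for V :: "pt set" and I :: "'i set" and F :: "'i \<Rightarrow> pt set" and N :: "'i \<Rightarrow> pt" +
  fixes \<omega> :: pt
  assumes finite_refl_group: "finite (refl_group I N)"
begin

abbreviation "T \<equiv> billiard_map V I F N"
abbreviation "S \<equiv> cross_section I F N \<omega>"
abbreviation "R \<equiv> discont_partition V I F N \<omega>"
abbreviation "reg \<equiv> regular_set V I F N \<omega>"
abbreviation "dirs \<equiv> orbit {\<omega>}"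

lemma finite_orbit: "finite X \<Longrightarrow> finite (orbit X)"
  using finite_refl_group by (simp add: orbit_def)

lemma finite_dirs: "finite dirs"
  by (simp add: finite_orbit)

lemma mem_cross_section: "(x, v) \<in> S \<longleftrightarrow> v \<in> dirs \<and> (\<exists>i\<in>I. x \<in> F i \<and> 0 < N i \<bullet> v)"
  by (auto simp: cross_section_def orbit_def)

lemma cross_sectionE:
  assumes "p \<in> S"
  obtains x v i where "p = (x, v)" "v \<in> dirs" "i \<in> I" "x \<in> F i" "0 < N i \<bullet> v"
  using assms mem_cross_section by (cases p) auto

lemma mem_regular_set: "(x, v) \<in> reg \<longleftrightarrow> v \<in> dirs \<and> (\<exists>i j. x \<in> transit i j v)"
proof
  assume "(x, v) \<in> reg"
  then obtain i j where i: "i \<in> I" "x \<in> face_core i" "0 < N i \<bullet> v"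
    and j: "j \<in> I" "hit_point V x v \<in> face_core j" and v: "v \<in> dirs"
    by (auto simp: regular_set_def face_core_def mem_cross_section)
  obtain y where "chord v x y" using chord_exists i by blast
  then have "x \<in> transit i j v" using transitI i(1,2) j hit_point_eq_chord_end by metis
  then show "v \<in> dirs \<and> (\<exists>i j. x \<in> transit i j v)" using v by blast
next
  assume "v \<in> dirs \<and> (\<exists>i j. x \<in> transit i j v)"
  then obtain i j where v: "v \<in> dirs" and x: "x \<in> transit i j v" by blast
  note flight = transitD[OF x]
  have "(x, v) \<in> S" using flight v face_core_subset by (auto simp: mem_cross_section)
  then show "(x, v) \<in> reg"
    using flight hit_point_eq_chord_end[OF flight(5)] by (auto simp: regular_set_def face_core_def)
qed

lemma regular_set_subset_S: "reg \<subseteq> S"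
  by (auto simp: regular_set_def)

lemma billiard_map_transit:
  assumes "x \<in> transit i j v"
  shows "T (x, v) = (shear i j v x, reflect (N j) v)"
proof -
  note flight = transitD[OF assms]
  have "(THE k. k \<in> I \<and> shear i j v x \<in> rel_interior (F k)) = j"
  proof (rule the_equality)
    show "j \<in> I \<and> shear i j v x \<in> rel_interior (F j)" using flight by (auto simp: face_core_def)
    show "k = j" if "k \<in> I \<and> shear i j v x \<in> rel_interior (F k)" for k
      using that flight face_core_index_unique rel_interior_subset by blast
  qed
  then show ?thesis by (simp add: billiard_map_def hit_point_eq_chord_end[OF flight(5)])
qed

lemma billiard_map_image_transit:
  "P \<subseteq> transit i j v \<Longrightarrow> T ` (P \<times> {v}) = shear i j v ` P \<times> {reflect (N j) v}"
  using billiard_map_transit by force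

lemma openin_transit_Times:
  assumes "v \<in> dirs"
  shows "openin (top_of_set reg) (transit i j v \<times> {v})"
proof -
  have "closed (dirs - {v})" using finite_dirs by (simp add: finite_imp_closed)
  then have "openin (top_of_set dirs) (dirs \<inter> - (dirs - {v}))"
    by (intro openin_open_Int open_Compl)
  moreover have "dirs \<inter> - (dirs - {v}) = {v}" using assms by blast
  ultimately have "openin (top_of_set (frontier V \<times> dirs)) (transit i j v \<times> {v})"
    using openin_transit(2) by (intro openin_Times) simp_all
  moreover have "reg \<subseteq> frontier V \<times> dirs"
  proof clarify
    fix x v assume "(x, v) \<in> reg"
    then obtain i j where "v \<in> dirs" "x \<in> transit i j v" using mem_regular_set by blast
    then show "x \<in> frontier V \<and> v \<in> dirs" using transitD(1,3) face_core_subset_frontier by blast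
  qed
  moreover have "transit i j v \<times> {v} \<subseteq> reg" using assms mem_regular_set by blast
  ultimately show ?thesis using openin_subset_trans by blast
qed

lemma connected_subset_transit_Times:
  assumes "connected C" "C \<subseteq> reg" "v \<in> dirs" "C \<inter> (transit i j v \<times> {v}) \<noteq> {}"
  shows "C \<subseteq> transit i j v \<times> {v}"
proof (rule connected_subset_disjoint_open_member)
  let ?\<D> = "{transit i j v \<times> {v} |i j v. v \<in> dirs}"
  have Union: "\<Union>?\<D> = reg"
  proof (rule set_eqI)
    show "p \<in> \<Union>?\<D> \<longleftrightarrow> p \<in> reg" for p using mem_regular_set by (cases p) auto
  qed
  show "connected C" "C \<subseteq> \<Union>?\<D>" "transit i j v \<times> {v} \<in> ?\<D>" "C \<inter> (transit i j v \<times> {v}) \<noteq> {}"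
    using assms Union by blast+
  show "openin (top_of_set (\<Union>?\<D>)) E" if "E \<in> ?\<D>" for E
    using that openin_transit_Times unfolding Union by blast
  show "pairwise disjnt ?\<D>"
  proof (rule pairwiseI, rule ccontr)
    fix D E assume "D \<in> ?\<D>" "E \<in> ?\<D>" and distinct: "D \<noteq> E" and "\<not> disjnt D E"
    then obtain i j i' j' v x where "D = transit i j v \<times> {v}" "E = transit i' j' v \<times> {v}"
      "x \<in> transit i j v" "x \<in> transit i' j' v"
      unfolding disjnt_iff by blast
    then show False using transit_disjoint distinct by metis
  qed
qed

lemma connected_component_regular_set:
  assumes "v \<in> dirs" "x \<in> transit i j v"
  shows "connected_component_set reg (x, v) = connected_component_set (transit i j v) x \<times> {v}"
proof
  let ?C = "connected_component_set reg (x, v)" and ?P = "connected_component_set (transit i j v) x"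
  have x: "(x, v) \<in> ?C" using assms mem_regular_set connected_component_refl by blast
  have C: "?C \<subseteq> transit i j v \<times> {v}"
    using connected_subset_transit_Times[OF connected_connected_component
        connected_component_subset]
      assms x by blast
  have "connected (fst ` ?C)"
    by (intro connected_continuous_image continuous_intros connected_connected_component)
  moreover have "fst ` ?C \<subseteq> transit i j v" using C by auto
  moreover have "x \<in> fst ` ?C" using x by (rule rev_image_eqI) simp
  ultimately have "fst ` ?C \<subseteq> ?P" by (intro connected_component_maximal)
  then show "?C \<subseteq> ?P \<times> {v}" using C by force
  have "connected (?P \<times> {v})" by (simp add: connected_Times)
  moreover have "?P \<times> {v} \<subseteq> reg"
    using connected_component_subset[of "transit i j v" x] assms(1) mem_regular_set by blast
  moreover have "(x, v) \<in> ?P \<times> {v}" using assms(2) by (simp add: connected_component_refl)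
  ultimately show "?P \<times> {v} \<subseteq> ?C" by (intro connected_component_maximal)
qed

lemma discont_partition_eq:
  "R = {P \<times> {v} |P v. v \<in> dirs \<and> (\<exists>i j. P \<in> components (transit i j v))}"
proof (intro equalityI subsetI)
  fix A assume "A \<in> R"
  then obtain x v where A: "(x, v) \<in> reg" "A = connected_component_set reg (x, v)"
    by (auto simp: discont_partition_def)
  then obtain i j where "v \<in> dirs" "x \<in> transit i j v" using mem_regular_set by blast
  then show "A \<in> {P \<times> {v} |P v. v \<in> dirs \<and> (\<exists>i j. P \<in> components (transit i j v))}"
    using A(2) connected_component_regular_set componentsI by blast
next
  fix A assume "A \<in> {P \<times> {v} |P v. v \<in> dirs \<and> (\<exists>i j. P \<in> components (transit i j v))}"
  then obtain i j v x where A: "A = connected_component_set (transit i j v) x \<times> {v}"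
    "v \<in> dirs" "x \<in> transit i j v" by (auto simp: components_iff)
  then have "A = connected_component_set reg (x, v)" "(x, v) \<in> reg"
    using connected_component_regular_set mem_regular_set by blast+
  then show "A \<in> R" unfolding discont_partition_def by blast
qed

lemma discont_partition_cases:
  assumes "A \<in> R"
  obtains i j v P where "A = P \<times> {v}" "v \<in> dirs" "P \<in> components (transit i j v)"
    "P \<subseteq> transit i j v" "P \<noteq> {}"
proof -
  obtain i j v P where "A = P \<times> {v}" "v \<in> dirs" "P \<in> components (transit i j v)"
    using assms unfolding discont_partition_eq by blast
  then show thesis using that in_components_subset in_components_nonempty by metis
qed

lemma discont_partition_eq_components: "R = components reg"
  by (auto simp: discont_partition_def components_def)

lemma Union_discont_partition: "\<Union>R = reg"
  by (simp add: discont_partition_eq_components)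

lemma finite_discont_partition: "finite R"
proof (rule finite_subset)
  show "R \<subseteq> (\<Union>i\<in>I. \<Union>j\<in>I. \<Union>v\<in>dirs. (\<lambda>P. P \<times> {v}) ` components (transit i j v))"
  proof
    fix A assume "A \<in> R"
    then obtain i j v P where "A = P \<times> {v}" "v \<in> dirs" "P \<in> components (transit i j v)"
      "P \<subseteq> transit i j v" "P \<noteq> {}" by (rule discont_partition_cases)
    moreover from this have "i \<in> I" "j \<in> I" using transitD(1,2) by blast+
    ultimately show "A \<in> (\<Union>i\<in>I. \<Union>j\<in>I. \<Union>v\<in>dirs. (\<lambda>P. P \<times> {v}) ` components (transit i j v))"
      by blast
  qed
qed (simp add: finite_I finite_dirs finite_components_transit)

lemma pairwise_disjnt_discont_partition: "pairwise disjnt R"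
  unfolding discont_partition_eq_components disjnt_def[abs_def]
  by (rule pairwise_disjoint_components)

lemma S_subset_closure_regular_set: "S \<subseteq> closure reg"
proof
  fix p assume "p \<in> S"
  then obtain x v i where p: "p = (x, v)" "v \<in> dirs" "i \<in> I" "x \<in> F i" "0 < N i \<bullet> v"
    by (rule cross_sectionE)
  then have "p \<in> closure (\<Union>j. transit i j v) \<times> closure {v}"
    using F_subset_closure_transit by auto
  also have "\<dots> = closure ((\<Union>j. transit i j v) \<times> {v})" by (simp add: closure_Times)
  also have "\<dots> \<subseteq> closure reg" using p(2) mem_regular_set by (intro closure_mono) blast
  finally show "p \<in> closure reg" .
qed

lemma polygon_partition_discont_partition: "polygon_partition S R"
proof -
  have "open_polygon A" if "A \<in> R" for A
    using that open_polygon_component_transit by (metis discont_partition_cases)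
  moreover have "A \<subseteq> S" if "A \<in> R" for A
    using that Union_discont_partition regular_set_subset_S by blast
  ultimately show ?thesis
    unfolding polygon_partition_def Union_discont_partition
    by (simp add: finite_discont_partition pairwise_disjnt_discont_partition
        S_subset_closure_regular_set)
qed

lemma inj_on_billiard_map: "inj_on T reg"
proof (rule inj_onI, safe)
  fix x v x' v' assume "(x, v) \<in> reg" "(x', v') \<in> reg" and eq: "T (x, v) = T (x', v')"
  then obtain i j i' j' where x: "x \<in> transit i j v" and x': "x' \<in> transit i' j' v'"
    using mem_regular_set by blast
  note flight = transitD[OF x] and flight' = transitD[OF x']
  have y: "shear i' j' v' x' = shear i j v x" "reflect (N j') v' = reflect (N j) v"
    using eq billiard_map_transit[OF x] billiard_map_transit[OF x'] by auto
  have "j' = j"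
    using flight(2,4) flight'(4) y(1) face_core_index_unique face_core_subset by (metis subsetD)
  then have v: "v' = v" using y(2) reflect_reflect norm_N[OF flight(2)] by metis
  then have "chord (- v) (shear i j v x) x" "chord (- v) (shear i j v x) x'"
    using flight(5) flight'(5) y(1) chord_reverse by metis+
  then show "x = x'" "v = v'" using v hit_point_eq_chord_end by metis+
qed

lemma billiard_map_in_S:
  assumes "p \<in> reg"
  shows "T p \<in> S"
proof -
  obtain x v where "p = (x, v)" by (cases p)
  then obtain i j where p: "p = (x, v)" "v \<in> dirs" "x \<in> transit i j v"
    using assms mem_regular_set by blast
  note flight = transitD[OF p(3)]
  have "reflect (N j) v \<in> dirs" "0 < N j \<bullet> reflect (N j) v"
    using reflect_in_orbit p(2) flight(2,7) inner_normal_reflect[OF norm_N[OF flight(2)]] by auto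
  then show ?thesis
    using flight(2,4) face_core_subset
    by (auto simp: p(1) billiard_map_transit[OF p(3)] mem_cross_section)
qed

lemma S_subset_closure_image: "S \<subseteq> closure (T ` reg)"
proof
  fix p assume "p \<in> S"
  then obtain y u j where p: "p = (y, u)" "u \<in> dirs" "j \<in> I" "y \<in> F j" "0 < N j \<bullet> u"
    by (rule cross_sectionE)
  define v where "v = reflect (N j) u"
  have v: "v \<in> dirs" "reflect (N j) v = u" "0 < N j \<bullet> (- v)"
    using p reflect_in_orbit norm_N[OF p(3)]
    by (simp_all add: v_def reflect_reflect inner_normal_reflect)
  have "(z, u) \<in> T ` reg" if z: "z \<in> transit j i (- v)" for z i
  proof -
    have "homeomorphism (transit j i (- v)) (transit i j v) (shear j i (- v)) (shear i j (- v))"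
      using homeomorphism_shear_transit[of j i "- v"] z by auto
    then have "shear j i (- v) z \<in> transit i j v" "shear i j v (shear j i (- v) z) = z"
      using z by (auto simp: homeomorphism_def shear_minus)
    then show ?thesis
      using v(1,2) billiard_map_transit mem_regular_set by (metis image_eqI)
  qed
  then have "(\<Union>i. transit j i (- v)) \<times> {u} \<subseteq> T ` reg" by blast
  then have "closure (\<Union>i. transit j i (- v)) \<times> closure {u} \<subseteq> closure (T ` reg)"
    using closure_mono by (metis closure_Times)
  moreover have "y \<in> closure (\<Union>i. transit j i (- v))"
    using F_subset_closure_transit[OF p(3) v(3)] p(4) by blast
  ultimately show "p \<in> closure (T ` reg)" using p(1) by auto
qed

lemma open_polygon_billiard_map_image:
  assumes "A \<in> R"
  shows "open_polygon (T ` A)"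
proof -
  obtain i j v P where A: "A = P \<times> {v}" and P: "P \<in> components (transit i j v)"
    "P \<subseteq> transit i j v" "P \<noteq> {}" using assms by (metis discont_partition_cases)
  then have "shear i j v ` P \<in> components (transit j i (- v))"
    using homeomorphism_image_components homeomorphism_shear_transit by blast
  then show ?thesis
    unfolding A billiard_map_image_transit[OF P(2)] by (rule open_polygon_component_transit)
qed

lemma homeomorphism_billiard_map:
  assumes "A \<in> R"
  shows "\<exists>g. homeomorphism A (T ` A) T g"
proof -
  obtain i j v P where A: "A = P \<times> {v}" and P: "P \<subseteq> transit i j v" "P \<noteq> {}"
    using assms by (metis discont_partition_cases)
  have inverse: "shear j i v (shear i j v x) = x" for x
    using shear_inverse[of i v j] transitD(6,7) P by fastforce
  have T: "(shear i j v (fst p), reflect (N j) v) = T p" if "p \<in> A" for p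
    using that billiard_map_transit P(1) A by auto
  have cont: "continuous_on C (\<lambda>p. (shear k l v (fst p), u))" for C k l and u :: pt
    by (intro continuous_intros continuous_on_compose2[OF continuous_on_shear[of UNIV]]) auto
  define rewind where "rewind q = (shear j i v (fst q), v)" for q :: phase
  have rewind: "rewind (T p) = p" if "p \<in> A" for p
    using that inverse A by (auto simp: rewind_def simp flip: T)
  have "continuous_on A T" using cont T by (rule continuous_on_eq)
  moreover have "continuous_on (T ` A) rewind" unfolding rewind_def by (rule cont)
  ultimately have "homeomorphism A (T ` A) T rewind"
    by (rule homeomorphismI) (auto simp: rewind)
  then show ?thesis by blast
qed

lemma smooth_extension_billiard_map:
  assumes "A \<in> R"
  shows "\<exists>W \<Phi>. A \<subseteq> W \<and> smooth_on W \<Phi> \<and> (\<forall>p\<in>A. \<Phi> p = T p)"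
proof -
  obtain i j v P where A: "A = P \<times> {v}" and P: "P \<subseteq> transit i j v"
    using assms by (metis discont_partition_cases)
  then have "(shear i j v (fst p), reflect (N j) v) = T p" if "p \<in> A" for p
    using that billiard_map_transit by auto
  then show ?thesis using smooth_on_shear_fst by blast
qed

lemma billiard_map_images_disjoint:
  assumes "A \<in> R" "B \<in> R" "A \<noteq> B"
  shows "T ` A \<inter> T ` B = {}"
proof -
  have "A \<inter> B = {}"
    using pairwise_disjnt_discont_partition assms by (meson disjnt_def pairwiseD)
  moreover have "A \<subseteq> reg" "B \<subseteq> reg" using assms Union_discont_partition by blast+
  ultimately show ?thesis using inj_on_image_Int[OF inj_on_billiard_map] by (metis image_empty)
qed

theorem gen_polygon_exchange_billiard_map: "gen_polygon_exchange S R T"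
  unfolding gen_polygon_exchange_def
proof (intro conjI ballI impI)
  show "polygon_partition S ((`) T ` R)"
    unfolding polygon_partition_def
  proof (intro conjI ballI)
    show "finite ((`) T ` R)" using finite_discont_partition by simp
    show "pairwise disjnt ((`) T ` R)"
      unfolding pairwise_def disjnt_def using billiard_map_images_disjoint by blast
    have "\<Union>((`) T ` R) = T ` reg" using Union_discont_partition by blast
    then show "S \<subseteq> closure (\<Union>((`) T ` R))" using S_subset_closure_image by simp
  next
    fix B assume "B \<in> (`) T ` R"
    then obtain A where A: "A \<in> R" "B = T ` A" by blast
    show "open_polygon B" using open_polygon_billiard_map_image A by blast
    show "B \<subseteq> S" using A Union_discont_partition billiard_map_in_S by blast
  qed
qed (use polygon_partition_discont_partition homeomorphism_billiard_map
    smooth_extension_billiard_map billiard_map_images_disjoint in blast)+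

end

section \<open>Itineraries and entropy\<close>

definition atom :: "'a set set \<Rightarrow> 'a \<Rightarrow> 'a set" where
  "atom U p = (THE A. A \<in> U \<and> p \<in> A)"

definition admissible :: "('a \<Rightarrow> 'a) \<Rightarrow> 'a set set \<Rightarrow> nat \<Rightarrow> 'a set" where
  "admissible T U n = {p. \<forall>k<n. (T ^^ k) p \<in> \<Union>U}"

definition itinerary :: "('a \<Rightarrow> 'a) \<Rightarrow> 'a set set \<Rightarrow> nat \<Rightarrow> 'a \<Rightarrow> 'a set list" where
  "itinerary T U n p = map (\<lambda>k. atom U ((T ^^ k) p)) [0..<n]"

lemma atom_eq:
  assumes "pairwise disjnt U" "A \<in> U" "p \<in> A"
  shows "atom U p = A"
  unfolding atom_def using assms by (intro the_equality) (auto simp: pairwise_def disjnt_iff)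

lemma admissible_0 [simp]: "admissible T U 0 = UNIV"
  by (simp add: admissible_def)

lemma admissible_Suc: "p \<in> admissible T U (Suc n) \<longleftrightarrow> p \<in> \<Union>U \<and> T p \<in> admissible T U n"
  by (simp add: admissible_def All_less_Suc2 funpow_swap1)

lemma admissible_mono: "m \<le> n \<Longrightarrow> admissible T U n \<subseteq> admissible T U m"
  by (auto simp: admissible_def)

lemma itinerary_0 [simp]: "itinerary T U 0 p = []"
  by (simp add: itinerary_def)

lemma itinerary_Suc: "itinerary T U (Suc n) p = atom U p # itinerary T U n (T p)"
  by (simp add: itinerary_def map_upt_Suc funpow_swap1 del: upt_Suc)

lemma itinerary_add: "itinerary T U (m + n) p = itinerary T U m p @ itinerary T U n ((T ^^ m) p)"
  by (induction m arbitrary: p) (simp_all add: itinerary_Suc funpow_swap1)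

lemma card_join_atoms_le_card_itineraries:
  assumes "pairwise disjnt U" "finite (itinerary T U n ` admissible T U n)"
  shows "card (join_atoms T U n) \<le> card (itinerary T U n ` admissible T U n)"
proof -
  let ?atom_of = "\<lambda>c. {p \<in> admissible T U n. itinerary T U n p = c}"
  have "join_atoms T U n \<subseteq> ?atom_of ` itinerary T U n ` admissible T U n"
  proof
    fix C assume "C \<in> join_atoms T U n"
    then obtain f where f: "\<forall>k<n. f k \<in> U" "C = {p. \<forall>k<n. (T ^^ k) p \<in> f k}" and "C \<noteq> {}"
      unfolding join_atoms_def by blast
    have "(T ^^ k) p \<in> f k \<longleftrightarrow> (T ^^ k) p \<in> \<Union>U \<and> atom U ((T ^^ k) p) = f k" if "k < n" for k p
      using f(1) that atom_eq[OF assms(1)] by (metis Union_iff)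
    then have C: "C = ?atom_of (map f [0..<n])"
      unfolding f(2) by (auto simp: admissible_def itinerary_def)
    then obtain p where "p \<in> admissible T U n" "itinerary T U n p = map f [0..<n]"
      using \<open>C \<noteq> {}\<close> by blast
    then have "map f [0..<n] \<in> itinerary T U n ` admissible T U n" by (metis imageI)
    then show "C \<in> ?atom_of ` itinerary T U n ` admissible T U n" unfolding C by (rule imageI)
  qed
  then have "card (join_atoms T U n) \<le> card (?atom_of ` itinerary T U n ` admissible T U n)"
    using assms(2) by (intro card_mono) simp
  also have "\<dots> \<le> card (itinerary T U n ` admissible T U n)" using assms(2) by (rule card_image_le)
  finally show ?thesis .
qed

lemma card_UN_le_mult:
  assumes "finite X" "\<And>x. x \<in> X \<Longrightarrow> finite (Y x) \<and> card (Y x) \<le> k"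
  shows "finite (\<Union>x\<in>X. Y x) \<and> card (\<Union>x\<in>X. Y x) \<le> card X * k"
proof
  show "finite (\<Union>x\<in>X. Y x)" using assms by blast
  have "card (\<Union>x\<in>X. Y x) \<le> (\<Sum>x\<in>X. card (Y x))" using assms(1) by (rule card_UN_le)
  also have "\<dots> \<le> card X * k" using assms(2) sum_bounded_above[of X "\<lambda>x. card (Y x)" k] by simp
  finally show "card (\<Union>x\<in>X. Y x) \<le> card X * k" .
qed

lemma card_itinerary_image_add_le:
  assumes first: "finite (itinerary T U m ` A)" "card (itinerary T U m ` A) \<le> k"
    and rest: "\<And>c. finite (itinerary T U n ` (T ^^ m) ` {p\<in>A. itinerary T U m p = c}) \<and>
      card (itinerary T U n ` (T ^^ m) ` {p\<in>A. itinerary T U m p = c}) \<le> l"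
  shows "finite (itinerary T U (m + n) ` A) \<and> card (itinerary T U (m + n) ` A) \<le> k * l"
proof -
  define tails where "tails c = itinerary T U n ` (T ^^ m) ` {p\<in>A. itinerary T U m p = c}" for c
  have "finite ((@) c ` tails c) \<and> card ((@) c ` tails c) \<le> l" for c
    using rest[of c] card_image_le[of "tails c" "(@) c"] unfolding tails_def by auto
  then have tails: "finite (\<Union>c\<in>itinerary T U m ` A. (@) c ` tails c)"
    "card (\<Union>c\<in>itinerary T U m ` A. (@) c ` tails c) \<le> card (itinerary T U m ` A) * l"
    using card_UN_le_mult[OF first(1), of "\<lambda>c. (@) c ` tails c"] by blast+
  have "itinerary T U (m + n) ` A \<subseteq> (\<Union>c\<in>itinerary T U m ` A. (@) c ` tails c)"
    unfolding itinerary_add tails_def by auto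
  then have "finite (itinerary T U (m + n) ` A)"
    "card (itinerary T U (m + n) ` A) \<le> card (itinerary T U m ` A) * l"
    using tails card_mono[OF tails(1)] by (auto intro: finite_subset order_trans)
  then show ?thesis using first(2) by (meson mult_le_mono1 order_trans)
qed

lemma card_itinerary_image_le_power:
  assumes count: "\<And>n A. n \<le> L \<Longrightarrow> small n A \<Longrightarrow>
      finite (itinerary T U n ` A) \<and> card (itinerary T U n ` A) \<le> q"
    and shorter: "\<And>n A. small (L + n) A \<Longrightarrow> small L A"
    and push: "\<And>n A c. small (L + n) A \<Longrightarrow> small n ((T ^^ L) ` {p\<in>A. itinerary T U L p = c})"
    and "0 < q"
  shows "n \<le> L * m \<Longrightarrow> small n A \<Longrightarrow>
    finite (itinerary T U n ` A) \<and> card (itinerary T U n ` A) \<le> q ^ m"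
proof (induction m arbitrary: n A)
  case 0
  then have "itinerary T U n ` A \<subseteq> {[]}" by auto
  then show ?case using card_mono[of "{[]}"] by (simp add: finite_subset)
next
  case (Suc m)
  show ?case
  proof (cases "n \<le> L")
    case True
    moreover have "q \<le> q ^ Suc m" using \<open>0 < q\<close> by (intro self_le_power) simp_all
    ultimately show ?thesis using count Suc.prems(2) by (meson order_trans)
  next
    case False
    define l where "l = n - L"
    have n: "n = L + l" "l \<le> L * m" using False Suc.prems(1) by (auto simp: l_def)
    have A: "small (L + l) A" using Suc.prems(2) n(1) by simp
    have "finite (itinerary T U L ` A)" "card (itinerary T U L ` A) \<le> q"
      using count[OF order_refl shorter[OF A]] by blast+
    then show ?thesis
      using card_itinerary_image_add_le Suc.IH[OF n(2) push[OF A]] unfolding n(1) power_Suc by blast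
  qed
qed

lemma partition_entropy_nonneg: "0 \<le> partition_entropy T U"
proof -
  have "0 \<le> ln (real k) / real n" for k n :: nat by (cases "k = 0") auto
  then show ?thesis unfolding partition_entropy_def by (intro le_Limsup always_eventually) auto
qed

lemma ln_le_of_le_mult_power_div:
  fixes k c q n L :: nat
  assumes "k \<le> c * q ^ (n div L + 1)" "1 \<le> q"
  shows "ln (real k) \<le> ln (real c + 1) + ln (real q) + real n / real L * ln (real q)"
proof (cases "k = 0")
  case True
  then show ?thesis using assms(2) by simp
next
  case False
  let ?m = "n div L"
  have "real k \<le> real (c * q ^ (?m + 1))" using assms(1) by (simp only: of_nat_le_iff)
  also have "\<dots> \<le> (real c + 1) * real q ^ (?m + 1)" by (simp add: mult_right_mono)
  finally have "ln (real k) \<le> ln ((real c + 1) * real q ^ (?m + 1))"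
    using False by (intro ln_mono) auto
  also have "\<dots> = ln (real c + 1) + ln (real q ^ (?m + 1))"
    using assms(2) by (intro ln_mult_pos) (auto simp: add_nonneg_pos)
  also have "\<dots> = ln (real c + 1) + ln (real q) + real ?m * ln (real q)"
    using assms(2) by (simp only: ln_realpow) (simp add: algebra_simps)
  also have "real ?m * ln (real q) \<le> real n / real L * ln (real q)"
    using assms(2) of_nat_div_le_of_nat[of n L] by (intro mult_right_mono) auto
  finally show ?thesis by simp
qed

lemma partition_entropy_le:
  assumes "1 \<le> q" "\<And>n. 0 < n \<Longrightarrow> card (join_atoms T U n) \<le> c * q ^ (n div L + 1)"
  shows "partition_entropy T U \<le> ereal (ln (real q) / real L)"
proof -
  define K where "K = ln (real c + 1) + ln (real q)"
  have bound: "ln (real (card (join_atoms T U n))) / real n \<le> K / real n + ln (real q) / real L"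
    if "0 < n" for n
  proof -
    have "ln (real (card (join_atoms T U n))) \<le> K + real n / real L * ln (real q)"
      using ln_le_of_le_mult_power_div[OF assms(2)[OF that] assms(1)] by (simp add: K_def)
    then have "ln (real (card (join_atoms T U n))) / real n
        \<le> (K + real n / real L * ln (real q)) / real n"
      by (intro divide_right_mono) auto
    then show ?thesis using that by (simp add: add_divide_distrib)
  qed
  have "partition_entropy T U \<le> limsup (\<lambda>n. ereal (K / real n + ln (real q) / real L))"
    unfolding partition_entropy_def
    by (rule Limsup_mono) (use bound in \<open>auto intro!: eventually_sequentiallyI[of 1]\<close>)
  also have "\<dots> = ereal (ln (real q) / real L)"
  proof (rule lim_imp_Limsup)
    have "(\<lambda>n. K / real n + ln (real q) / real L) \<longlonglongrightarrow> 0 + ln (real q) / real L"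
      by (intro tendsto_intros lim_const_over_n)
    then show "(\<lambda>n. ereal (K / real n + ln (real q) / real L)) \<longlonglongrightarrow> ereal (ln (real q) / real L)"
      by simp
  qed simp
  finally show ?thesis .
qed

section \<open>Counting itineraries\<close>

locale cut_system = rational_billiard V I F N \<omega>
  for V :: "pt set" and I :: "'i set" and F :: "'i \<Rightarrow> pt set" and N :: "'i \<Rightarrow> pt" and \<omega> :: pt +
  fixes U :: "phase set set" and W :: "pt set" and Z :: "real set"
  assumes partition_U: "polygon_partition S U" and refines_U: "refines U R"
    and finite_W: "finite W" and finite_Z: "finite Z" and zero_notin_W: "0 \<notin> W"
    and W_reflect: "w \<in> W \<Longrightarrow> i \<in> I \<Longrightarrow> reflect (N i) w \<in> W"
    and rel_frontier_subset_planes: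
      "P \<times> {v} \<in> U \<Longrightarrow> rel_frontier P \<subseteq> planes_Union ({w\<in>W. w \<bullet> v = 0} \<times> Z)"
begin

abbreviation "adm \<equiv> admissible T U"
abbreviation "itin \<equiv> itinerary T U"

lemma atom_U: "A \<in> U \<Longrightarrow> p \<in> A \<Longrightarrow> atom U p = A"
  using partition_U by (intro atom_eq) (auto simp: polygon_partition_def)

lemma Union_U_E:
  assumes "(x, v) \<in> \<Union>U"
  obtains P where "P \<times> {v} \<in> U" "x \<in> P"
proof -
  obtain A where A: "A \<in> U" "(x, v) \<in> A" using assms by blast
  then have "open_polygon A" using partition_U by (simp add: polygon_partition_def)
  then obtain P where "A = P \<times> {v}" using A(2) by (auto simp: open_polygon_def)
  then show thesis using that A by blast
qed

lemma U_subset_transit: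
  assumes "P \<times> {v} \<in> U"
  obtains i j where "P \<subseteq> transit i j v"
proof -
  obtain B where B: "B \<in> R" "P \<times> {v} \<subseteq> B" using refines_U assms by (auto simp: refines_def)
  obtain i j u Q where "B = Q \<times> {u}" "Q \<subseteq> transit i j u"
    using B(1) by (metis discont_partition_cases)
  then have "P \<subseteq> transit i j v" using B(2) by auto
  then show thesis by (rule that)
qed

lemma Union_U_transit:
  assumes "(x, v) \<in> \<Union>U"
  obtains i j where "x \<in> transit i j v"
proof -
  obtain P where P: "P \<times> {v} \<in> U" "x \<in> P" using assms by (rule Union_U_E)
  obtain i j where "P \<subseteq> transit i j v" using P(1) by (rule U_subset_transit)
  then show thesis using that P(2) by blast
qed

lemma U_subset_transit_from:
  assumes "P \<times> {v} \<in> U" "x \<in> P" "i \<in> I" "x \<in> face_core i"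
  obtains j where "P \<subseteq> transit i j v"
proof -
  obtain k j where P: "P \<subseteq> transit k j v" using assms(1) by (rule U_subset_transit)
  then have "k = i"
    using transitD(1,3) assms(2-4) face_core_index_unique face_core_subset by (metis subsetD)
  then show thesis using that P by blast
qed

lemma affine_hull_U:
  assumes "P \<times> {v} \<in> U" "x \<in> P" "i \<in> I" "x \<in> face_core i"
  shows "affine hull P = face_plane i"
proof -
  obtain j where "P \<subseteq> transit i j v" using assms by (rule U_subset_transit_from)
  moreover have "open_polygon (P \<times> {v})"
    using partition_U assms(1) by (simp add: polygon_partition_def)
  then have "aff_dim P = 2" using assms(2) by (auto simp: open_polygon_def times_eq_iff)
  ultimately show ?thesis
    using transit_subset_face_plane assms(3) by (intro affine_hull_eq_face_plane) blast+
qed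

lemma rel_interior_U:
  assumes "P \<times> {v} \<in> U"
  shows "rel_interior P = P"
proof -
  have "open_polygon (P \<times> {v})" using partition_U assms by (simp add: polygon_partition_def)
  then show ?thesis by (auto simp: open_polygon_def times_eq_iff)
qed

fun levels :: "nat \<Rightarrow> real set" where
  "levels 0 = {}"
| "levels (Suc n) = Z \<union> (\<Union>j\<in>I. \<Union>w\<in>W. (\<lambda>z. z + 2 * offset j * (w \<bullet> N j)) ` levels n)"

definition cut_planes :: "nat \<Rightarrow> pt \<Rightarrow> (pt \<times> real) set" where
  "cut_planes n v = {w\<in>W. w \<bullet> v = 0} \<times> levels n"

definition cuts :: "nat \<Rightarrow> pt \<Rightarrow> pt set" where
  "cuts n v = planes_Union (cut_planes n v)"

definition generic :: "nat \<Rightarrow> phase set" where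
  "generic n = {p \<in> adm n. fst p \<notin> cuts n (snd p)}"

definition close :: "real \<Rightarrow> phase \<Rightarrow> phase \<Rightarrow> bool" where
  "close \<delta> p q \<longleftrightarrow> snd p = snd q \<and> (\<exists>i\<in>I. fst p \<in> face_core i \<and> fst q \<in> face_core i) \<and>
     (\<forall>w\<in>W. w \<bullet> snd p = 0 \<longrightarrow> \<bar>w \<bullet> fst p - w \<bullet> fst q\<bar> < \<delta>)"

lemma finite_levels: "finite (levels n)"
  by (induction n) (auto simp: finite_Z finite_I finite_W)

lemma levels_mono: "m \<le> n \<Longrightarrow> levels m \<subseteq> levels n"
proof (rule lift_Suc_mono_le)
  fix n show "levels n \<subseteq> levels (Suc n)"
  proof (induction n)
    case (Suc n)
    then have "(\<lambda>z. z + c) ` levels n \<subseteq> (\<lambda>z. z + c) ` levels (Suc n)" for c by (rule image_mono)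
    then show ?case by (subst (1 2) levels.simps) (intro Un_mono UN_mono order_refl, blast)
  qed simp
qed

lemma cuts_mono: "m \<le> n \<Longrightarrow> cuts m v \<subseteq> cuts n v"
  unfolding cuts_def cut_planes_def using levels_mono
  by (intro planes_Union_mono Sigma_mono) auto

lemma mem_cuts: "x \<in> cuts n v \<longleftrightarrow> (\<exists>w\<in>W. w \<bullet> v = 0 \<and> w \<bullet> x \<in> levels n)"
  by (auto simp: cuts_def cut_planes_def mem_planes_Union)

lemma parallel_cut_planes: "parallel_planes v (cut_planes n v)"
  using finite_W finite_levels zero_notin_W by (auto simp: parallel_planes_def cut_planes_def)

lemma rel_frontier_subset_cuts:
  assumes "P \<times> {v} \<in> U"
  shows "rel_frontier P \<subseteq> cuts (Suc n) v"
proof -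
  have "{w\<in>W. w \<bullet> v = 0} \<times> Z \<subseteq> cut_planes (Suc n) v" by (auto simp: cut_planes_def)
  then show ?thesis
    unfolding cuts_def using rel_frontier_subset_planes[OF assms] planes_Union_mono by blast
qed

text \<open>In coordinates transverse to the direction of motion the billiard map is a piecewise
  translation, up to relabelling the functionals by a reflection.\<close>

lemma inner_shear_eq_inner_reflect:
  assumes j: "j \<in> I" "height j (shear i j v x) = 0" and w: "w \<bullet> reflect (N j) v = 0"
  shows "reflect (N j) w \<bullet> v = 0"
    "w \<bullet> shear i j v x = reflect (N j) w \<bullet> x - 2 * offset j * (reflect (N j) w \<bullet> N j)"
proof -
  note unit = norm_N[OF j(1)]
  let ?w = "reflect (N j) w" and ?y = "shear i j v x"
  show orthogonal: "?w \<bullet> v = 0"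
    using inner_reflect_reflect[OF unit, of ?w v] reflect_reflect[OF unit] w by simp
  have "reflect (N j) ?y = ?y - (2 * offset j) *\<^sub>R N j"
    using j(2) by (simp add: reflect_def height_def)
  moreover have "w \<bullet> ?y = ?w \<bullet> reflect (N j) ?y" using inner_reflect_reflect[OF unit] by simp
  ultimately show "w \<bullet> ?y = ?w \<bullet> x - 2 * offset j * (?w \<bullet> N j)"
    using inner_shear[OF orthogonal] by (simp add: inner_diff_right)
qed

lemma shear_in_cuts_imp:
  assumes j: "j \<in> I" "height j (shear i j v x) = 0"
    and cut: "shear i j v x \<in> cuts n (reflect (N j) v)"
  shows "x \<in> cuts (Suc n) v"
proof -
  obtain w z where w: "w \<in> W" "w \<bullet> reflect (N j) v = 0" "z \<in> levels n" "w \<bullet> shear i j v x = z"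
    using cut by (auto simp: mem_cuts)
  let ?w = "reflect (N j) w"
  have W: "?w \<in> W" using W_reflect w(1) j(1) by blast
  note shift = inner_shear_eq_inner_reflect[OF j w(2)]
  have "?w \<bullet> x = z + 2 * offset j * (?w \<bullet> N j)" using shift(2) w(4) by simp
  then have "?w \<bullet> x \<in> levels (Suc n)" using w(3) W j(1) by auto
  then show ?thesis using W shift(1) by (auto simp: mem_cuts)
qed

lemma generic_billiard_map:
  assumes "p \<in> generic (Suc n)"
  shows "T p \<in> generic n"
proof -
  obtain x v where p: "p = (x, v)" by (cases p)
  have adm: "(x, v) \<in> \<Union>U" "T p \<in> adm n"
    using assms p by (simp_all add: generic_def admissible_Suc)
  obtain i j where x: "x \<in> transit i j v" using adm(1) by (rule Union_U_transit)
  note flight = transitD[OF x]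
  have "x \<notin> cuts (Suc n) v" using assms p by (simp add: generic_def)
  then have "shear i j v x \<notin> cuts n (reflect (N j) v)"
    using shear_in_cuts_imp flight(2) height_face_core[OF flight(2,4)] by blast
  then show ?thesis using adm(2) p billiard_map_transit[OF x] by (simp add: generic_def)
qed

lemma generic_funpow: "p \<in> generic (m + n) \<Longrightarrow> (T ^^ m) p \<in> generic n"
  by (induction m arbitrary: p) (simp_all add: funpow_swap1 generic_billiard_map)

lemma generic_mono: "m \<le> n \<Longrightarrow> generic n \<subseteq> generic m"
  using admissible_mono[of m n T U] cuts_mono by (fastforce simp: generic_def)

lemma close_billiard_map:
  assumes P: "P \<times> {v} \<in> U" "x \<in> P" "y \<in> P" and close: "close \<delta> (x, v) (y, v)"
  shows "close \<delta> (T (x, v)) (T (y, v))"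
proof -
  obtain i j where xy: "x \<in> transit i j v" "y \<in> transit i j v"
    using U_subset_transit[OF P(1)] P(2,3) by (metis subsetD)
  note flight_x = transitD[OF xy(1)] and flight_y = transitD[OF xy(2)]
  have "\<bar>w \<bullet> shear i j v x - w \<bullet> shear i j v y\<bar> < \<delta>" if "w \<in> W" "w \<bullet> reflect (N j) v = 0" for w
  proof -
    note shift_x = inner_shear_eq_inner_reflect[OF flight_x(2) _ that(2), of i x]
      and shift_y = inner_shear_eq_inner_reflect[OF flight_y(2) _ that(2), of i y]
    have "reflect (N j) w \<in> W" using W_reflect that(1) flight_x(2) by blast
    then show ?thesis using close shift_x shift_y height_face_core flight_x(2,4) flight_y(4)
      by (simp add: close_def)
  qed
  then show ?thesis
    using flight_x(2,4) flight_y(4) billiard_map_transit[OF xy(1)] billiard_map_transit[OF xy(2)]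
    by (auto simp: close_def)
qed

lemma close_funpow:
  "p \<in> adm n \<Longrightarrow> q \<in> adm n \<Longrightarrow> itin n p = itin n q \<Longrightarrow> close \<delta> p q \<Longrightarrow>
    close \<delta> ((T ^^ n) p) ((T ^^ n) q)"
proof (induction n arbitrary: p q)
  case (Suc n)
  obtain x y v where pq: "p = (x, v)" "q = (y, v)"
    using Suc.prems(4) by (metis close_def prod.collapse)
  have "(x, v) \<in> \<Union>U" "(y, v) \<in> \<Union>U" using Suc.prems(1,2) pq by (simp_all add: admissible_Suc)
  then obtain P Q where P: "P \<times> {v} \<in> U" "x \<in> P" and Q: "Q \<times> {v} \<in> U" "y \<in> Q"
    using Union_U_E by metis
  have "atom U (x, v) = atom U (y, v)" using Suc.prems(3) pq by (simp add: itinerary_Suc)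
  then have "y \<in> P" using atom_U[OF P(1)] atom_U[OF Q(1)] P(2) Q(2) by (auto simp: times_eq_iff)
  then have "close \<delta> (T p) (T q)" using close_billiard_map[OF P] Suc.prems(4) pq by blast
  then show ?case
    using Suc.IH[of "T p" "T q"] Suc.prems by (simp add: admissible_Suc itinerary_Suc funpow_swap1)
qed simp

lemma mem_atom_if_segment_off_cuts:
  assumes A: "P \<times> {v} \<in> U" "x \<in> P" and i: "i \<in> I" "x \<in> face_core i" "y \<in> face_core i"
    and off: "closed_segment x y \<inter> cuts (Suc n) v = {}"
  shows "y \<in> P"
proof -
  have "closed_segment x y \<subseteq> rel_interior P"
  proof (rule connected_subset_rel_interior)
    show "closed_segment x y \<subseteq> affine hull P"
      using i height_face_core unfolding affine_hull_U[OF A i(1,2)] face_plane_def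
      by (intro closed_segment_subset convex_hyperplane) (simp_all add: height_def)
    show "closed_segment x y \<inter> rel_interior P \<noteq> {}" using A rel_interior_U by auto
    show "closed_segment x y \<inter> rel_frontier P = {}"
      using rel_frontier_subset_cuts[OF A(1)] off by blast
  qed simp
  then show ?thesis using rel_interior_U[OF A(1)] by auto
qed

lemma itinerary_eq_if_segment_off_cuts:
  "(x, v) \<in> adm n \<Longrightarrow> i \<in> I \<Longrightarrow> x \<in> face_core i \<Longrightarrow> y \<in> face_core i \<Longrightarrow>
    closed_segment x y \<inter> cuts n v = {} \<Longrightarrow> itin n (y, v) = itin n (x, v)"
proof (induction n arbitrary: x y v i)
  case (Suc n)
  have "(x, v) \<in> \<Union>U" using Suc.prems(1) by (simp add: admissible_Suc)
  then obtain P where P: "P \<times> {v} \<in> U" "x \<in> P" by (rule Union_U_E)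
  have y_in_P: "y \<in> P" using mem_atom_if_segment_off_cuts[OF P] Suc.prems(2-5) by blast
  then obtain k j where x: "x \<in> transit k j v" and y: "y \<in> transit k j v"
    using U_subset_transit[OF P(1)] P(2) by (metis subsetD)
  have "closed_segment x y \<subseteq> face_plane k"
    using x y transit_subset_face_plane unfolding face_plane_def
    by (intro closed_segment_subset convex_hyperplane) blast+
  then have "height j (shear k j v z) = 0" if "z \<in> closed_segment x y" for z
    using that height_shear[of j v k z] transitD(7)[OF x] by (auto simp: mem_face_plane)
  then have "shear k j v ` closed_segment x y \<inter> cuts n (reflect (N j) v) = {}"
    using shear_in_cuts_imp[OF transitD(2)[OF x]] Suc.prems(5) by blast
  moreover have "(shear k j v x, reflect (N j) v) \<in> adm n"
    using Suc.prems(1) billiard_map_transit[OF x] by (simp add: admissible_Suc)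
  ultimately have "itin n (T (y, v)) = itin n (T (x, v))"
    using Suc.IH transitD(2,4)[OF x] transitD(4)[OF y]
    by (simp add: shear_closed_segment billiard_map_transit[OF x] billiard_map_transit[OF y])
  then show ?case
    using atom_U[OF P(1)] P(2) y_in_P by (simp add: itinerary_Suc)
qed simp

lemma itinerary_eq_if_planes_below_eq:
  assumes pq: "p \<in> generic n" "q \<in> generic n" "close \<delta> p q"
    and below: "planes_below (cut_planes n (snd p)) (fst p) =
      planes_below (cut_planes n (snd p)) (fst q)"
  shows "itin n p = itin n q"
proof -
  obtain x y v where xy: "p = (x, v)" "q = (y, v)"
    using pq(3) by (metis close_def prod.collapse)
  obtain i where i: "i \<in> I" "x \<in> face_core i" "y \<in> face_core i"
    using pq(3) xy by (auto simp: close_def)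
  have "closed_segment x y \<inter> cuts n v = {}"
    using pq(1,2) below xy unfolding cuts_def
    by (intro closed_segment_disjoint_planes_Union) (simp_all add: generic_def cuts_def)
  then show ?thesis
    using itinerary_eq_if_segment_off_cuts[of x v n i y] i pq(1) xy by (simp add: generic_def)
qed

lemma card_itinerary_image_close_le:
  assumes gap: "\<And>a b. a \<in> levels n \<Longrightarrow> b \<in> levels n \<Longrightarrow> dist a b < \<delta> \<Longrightarrow> a = b"
    and generic: "A \<subseteq> generic n" and close: "\<And>p q. p \<in> A \<Longrightarrow> q \<in> A \<Longrightarrow> close \<delta> p q"
  shows "finite (itin n ` A) \<and> card (itin n ` A) \<le> 2 ^ card W"
proof (cases "A = {}")
  case False
  then obtain v where v: "\<And>p. p \<in> A \<Longrightarrow> snd p = v" using close unfolding close_def by blast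
  let ?W = "{w\<in>W. w \<bullet> v = 0}"
  let ?below = "planes_below (cut_planes n v)"
  have off: "fst ` A \<inter> planes_Union (?W \<times> levels n) = {}"
    using generic v by (auto simp: generic_def cuts_def cut_planes_def)
  have narrow: "\<bar>w \<bullet> x - w \<bullet> y\<bar> < \<delta>" if "x \<in> fst ` A" "y \<in> fst ` A" "w \<in> ?W" for x y w
    using that close v by (fastforce simp: close_def)
  have "finite ?W" using finite_W by simp
  from card_planes_below_image_le[OF this off gap narrow]
  have cells: "finite ((\<lambda>p. ?below (fst p)) ` A)" "card ((\<lambda>p. ?below (fst p)) ` A) \<le> 2 ^ card ?W"
    unfolding image_image cut_planes_def by blast+
  have same: "itin n p = itin n q" if "p \<in> A" "q \<in> A" "?below (fst p) = ?below (fst q)" for p q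
    using itinerary_eq_if_planes_below_eq[OF _ _ close[OF that(1,2)]] generic v that by blast
  have "finite (itin n ` A)" by (rule card_image_le_card_image(1)[OF cells(1) same])
  moreover have "card (itin n ` A) \<le> card ((\<lambda>p. ?below (fst p)) ` A)"
    by (rule card_image_le_card_image(2)[OF cells(1) same])
  moreover have "(2::nat) ^ card ?W \<le> 2 ^ card W"
    using finite_W by (intro power_increasing card_mono) auto
  ultimately show ?thesis using cells(2) by linarith
qed simp

lemma eventually_mem_atom:
  assumes P: "P \<times> {v} \<in> U" "x \<in> P" and i: "i \<in> I" "x \<in> face_core i"
  shows "\<forall>\<^sub>F y in nhds x. y \<in> face_plane i \<longrightarrow> y \<in> P"
proof -
  have "openin (top_of_set (face_plane i)) P"
    using openin_rel_interior[of P] affine_hull_U[OF P i] rel_interior_U[OF P(1)] by simp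
  then show ?thesis using P(2) by (simp add: openin_iff_eventually_nhds)
qed

lemma eventually_itinerary_eq:
  "(x, v) \<in> adm n \<Longrightarrow> i \<in> I \<Longrightarrow> x \<in> face_core i \<Longrightarrow>
    \<forall>\<^sub>F y in nhds x. y \<in> face_plane i \<longrightarrow> (y, v) \<in> adm n \<and> itin n (y, v) = itin n (x, v)"
proof (induction n arbitrary: x v i)
  case (Suc n)
  have "(x, v) \<in> \<Union>U" using Suc.prems(1) by (simp add: admissible_Suc)
  then obtain P where P: "P \<times> {v} \<in> U" "x \<in> P" by (rule Union_U_E)
  then obtain j where P_transit: "P \<subseteq> transit i j v"
    using Suc.prems(2,3) by (rule U_subset_transit_from)
  have x: "x \<in> transit i j v" using P(2) P_transit by blast
  have "\<forall>\<^sub>F y in nhds x. y \<in> face_plane i \<longrightarrow> y \<in> P"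
    using P Suc.prems(2,3) by (rule eventually_mem_atom)
  moreover have "(shear i j v x, reflect (N j) v) \<in> adm n"
    using Suc.prems(1) billiard_map_transit[OF x] by (simp add: admissible_Suc)
  then have "\<forall>\<^sub>F z in nhds (shear i j v x). z \<in> face_plane j \<longrightarrow>
      (z, reflect (N j) v) \<in> adm n \<and> itin n (z, reflect (N j) v) = itin n (T (x, v))"
    using Suc.IH transitD(2,4)[OF x] billiard_map_transit[OF x] by simp
  note eventually_nhds_isCont[OF isCont_shear this]
  ultimately show ?case
  proof eventually_elim
    case (elim y)
    show ?case
    proof
      assume "y \<in> face_plane i"
      then have y_in_P: "y \<in> P" using elim(1) by blast
      then have y: "y \<in> transit i j v" using P_transit by blast
      have "shear i j v y \<in> face_plane j"
        using transitD(2,4)[OF y] height_face_core mem_face_plane by blast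
      then have "T (y, v) \<in> adm n" "itin n (T (y, v)) = itin n (T (x, v))"
        using elim(2) billiard_map_transit[OF y] by auto
      moreover have "(y, v) \<in> \<Union>U" using y_in_P P(1) by blast
      moreover have "atom U (y, v) = atom U (x, v)" using atom_U[OF P(1)] P(2) y_in_P by simp
      ultimately show "(y, v) \<in> adm (Suc n) \<and> itin (Suc n) (y, v) = itin (Suc n) (x, v)"
        by (simp add: admissible_Suc itinerary_Suc)
    qed
  qed
qed simp

lemma generic_subset_regular_set:
  assumes "0 < n"
  shows "generic n \<subseteq> reg"
proof
  fix p assume "p \<in> generic n"
  then have "p \<in> \<Union>U" using assms by (cases n) (auto simp: generic_def admissible_Suc)
  then show "p \<in> reg" using refines_U Union_discont_partition by (fastforce simp: refines_def)
qed

lemma exists_generic_same_itinerary: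
  assumes "p \<in> adm n" "0 < n"
  shows "\<exists>q\<in>generic n. itin n q = itin n p"
proof -
  obtain x v where p: "p = (x, v)" by (cases p)
  have "(x, v) \<in> \<Union>U" using assms p by (cases n) (auto simp: admissible_Suc)
  then obtain i j where x: "x \<in> transit i j v" by (rule Union_U_transit)
  note flight = transitD[OF x]
  obtain O' where O': "open O'" "x \<in> O'"
    "\<And>y. y \<in> O' \<Longrightarrow> y \<in> face_plane i \<Longrightarrow> (y, v) \<in> adm n \<and> itin n (y, v) = itin n p"
    using eventually_itinerary_eq[of x v n i] assms(1) flight(1,3) p
    unfolding eventually_nhds by auto
  have "transit i j v \<subseteq> closure (transit i j v - cuts n v)"
    unfolding cuts_def
    using openin_hyperplane_subset_closure_diff_planes[OF _ _ parallel_cut_planes,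
        of "N i" "offset i"]
      openin_transit(1) flight(6) by (simp add: face_plane_def)
  then obtain y where y: "y \<in> O'" "y \<in> transit i j v" "y \<notin> cuts n v"
    using O'(1,2) x open_Int_closure_eq_empty[OF O'(1)] by blast
  then have "y \<in> face_plane i" using transit_subset_face_plane by blast
  then have "(y, v) \<in> adm n" "itin n (y, v) = itin n p" using O'(3) y(1) by blast+
  then show ?thesis using y(3) by (intro bexI[of _ "(y, v)"]) (simp_all add: generic_def)
qed

lemma exists_radius_close:
  assumes "0 < \<delta>"
  obtains r where "0 < r" "\<And>i v x y. i \<in> I \<Longrightarrow> x \<in> face_core i \<Longrightarrow> y \<in> face_core i \<Longrightarrow>
    dist x y < r \<Longrightarrow> close \<delta> (x, v) (y, v)"
proof -
  obtain M where M: "0 < M" "\<And>w. w \<in> W \<Longrightarrow> norm w \<le> M"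
    using finite_imp_bounded[OF finite_W] by (metis bounded_pos)
  have "\<bar>w \<bullet> x - w \<bullet> y\<bar> < \<delta>" if "dist x y < \<delta> / M" "w \<in> W" for w x y
  proof -
    have "\<bar>w \<bullet> x - w \<bullet> y\<bar> \<le> norm w * dist x y"
      using Cauchy_Schwarz_ineq2[of w "x - y"] by (simp add: inner_diff_right dist_norm)
    also have "\<dots> \<le> M * dist x y" using M(2)[OF that(2)] by (simp add: mult_right_mono)
    also have "\<dots> < \<delta>" using that(1) M(1) by (simp add: field_simps)
    finally show ?thesis .
  qed
  then show thesis using that[of "\<delta> / M"] assms M(1) by (auto simp: close_def)
qed

lemma finite_close_cover:
  assumes "0 < \<delta>"
  shows "\<exists>\<C>. finite \<C> \<and> reg \<subseteq> \<Union>\<C> \<and> (\<forall>A\<in>\<C>. \<forall>p\<in>A. \<forall>q\<in>A. close \<delta> p q)"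
proof -
  obtain r where r: "0 < r" and close: "\<And>i v x y. i \<in> I \<Longrightarrow> x \<in> face_core i \<Longrightarrow>
      y \<in> face_core i \<Longrightarrow> dist x y < r \<Longrightarrow> close \<delta> (x, v) (y, v)"
    using exists_radius_close[OF assms] by metis
  then have "0 < r / 2" by simp
  then obtain B where B: "finite B" "V \<subseteq> (\<Union>b\<in>B. ball b (r / 2))"
    using compact_V by (metis compact_eq_totally_bounded)
  define piece where "piece = (\<lambda>(i, v::pt, b). (face_core i \<inter> ball b (r / 2)) \<times> {v})"
  let ?\<C> = "piece ` (I \<times> dirs \<times> B)"
  have "close \<delta> p q" if pq: "A \<in> ?\<C>" "p \<in> A" "q \<in> A" for A p q
  proof -
    obtain i b v x y where xy: "p = (x, v)" "q = (y, v)" "i \<in> I" "x \<in> face_core i" "y \<in> face_core i"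
      and "dist b x < r / 2" "dist b y < r / 2" using pq by (auto simp: piece_def)
    then have "dist x y < r" using dist_triangle_half_r by blast
    then show ?thesis using close xy by blast
  qed
  moreover have "reg \<subseteq> \<Union>?\<C>"
  proof clarify
    fix x v assume "(x, v) \<in> reg"
    then obtain i j where x: "x \<in> transit i j v" "v \<in> dirs" using mem_regular_set by blast
    have "x \<in> V"
      using face_core_subset_frontier transitD(1,3)[OF x(1)] frontier_subset_compact[OF compact_V]
      by blast
    then obtain b where "b \<in> B" "x \<in> ball b (r / 2)" using B(2) by blast
    then show "(x, v) \<in> \<Union>?\<C>"
      using transitD(1,3)[OF x(1)] x(2)
      by (intro UnionI[of "piece (i, v, b)"]) (auto simp: piece_def)
  qed
  ultimately show ?thesis using B(1) finite_I finite_dirs by (intro exI[of _ ?\<C>]) blast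
qed

lemma card_itinerary_image_le:
  assumes gap: "\<And>a b. a \<in> levels L \<Longrightarrow> b \<in> levels L \<Longrightarrow> dist a b < \<delta> \<Longrightarrow> a = b"
    and "n \<le> L * m" "A \<subseteq> generic n" "\<And>p q. p \<in> A \<Longrightarrow> q \<in> A \<Longrightarrow> close \<delta> p q"
  shows "finite (itin n ` A) \<and> card (itin n ` A) \<le> (2 ^ card W) ^ m"
proof -
  define small where "small n A \<longleftrightarrow> A \<subseteq> generic n \<and> (\<forall>p\<in>A. \<forall>q\<in>A. close \<delta> p q)" for n A
  have push: "small n ((T ^^ L) ` {p\<in>A. itin L p = c})" if A: "small (L + n) A" for n A c
  proof -
    have "p \<in> adm L" "(T ^^ L) p \<in> generic n" if "p \<in> A" for p
    proof -
      have p: "p \<in> generic (L + n)" using that A by (auto simp: small_def)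
      then show "(T ^^ L) p \<in> generic n" by (rule generic_funpow)
      have "p \<in> generic L" using p generic_mono[of L "L + n"] by auto
      then show "p \<in> adm L" by (simp add: generic_def)
    qed
    then show ?thesis using A close_funpow by (auto simp: small_def)
  qed
  have shorter: "small L A" if "small (L + n) A" for n A
    using that generic_mono[of L "L + n"] by (auto simp: small_def)
  have count: "finite (itin n ` A) \<and> card (itin n ` A) \<le> 2 ^ card W"
    if "n \<le> L" "small n A" for n A
  proof (rule card_itinerary_image_close_le)
    show "a = b" if "a \<in> levels n" "b \<in> levels n" "dist a b < \<delta>" for a b
      using that gap levels_mono[OF \<open>n \<le> L\<close>] by blast
  qed (use \<open>small n A\<close> in \<open>auto simp: small_def\<close>)
  have "small n A" using assms(3,4) by (simp add: small_def)
  from card_itinerary_image_le_power[of L small, OF count shorter push _ assms(2) this]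
  show ?thesis by simp
qed

lemma card_join_atoms_le:
  assumes "0 < L"
  shows "\<exists>c. \<forall>n>0. card (join_atoms T U n) \<le> c * (2 ^ card W) ^ (n div L + 1)"
proof -
  have "uniform_discrete (levels L)" using finite_levels uniform_discrete_finite_iff by blast
  then obtain \<delta> where \<delta>: "0 < \<delta>"
    "\<And>a b. a \<in> levels L \<Longrightarrow> b \<in> levels L \<Longrightarrow> dist a b < \<delta> \<Longrightarrow> a = b"
    unfolding uniform_discrete_def by blast
  obtain \<C> where \<C>: "finite \<C>" "reg \<subseteq> \<Union>\<C>" "\<And>A p q. A \<in> \<C> \<Longrightarrow> p \<in> A \<Longrightarrow> q \<in> A \<Longrightarrow> close \<delta> p q"
    using finite_close_cover[OF \<delta>(1)] by metis
  have "card (join_atoms T U n) \<le> card \<C> * (2 ^ card W) ^ (n div L + 1)" if "0 < n" for n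
  proof -
    have "n \<le> L * (n div L + 1)"
      using dividend_less_div_times[OF assms, of n] by (simp add: algebra_simps)
    then have "finite (itin n ` (A \<inter> generic n)) \<and>
        card (itin n ` (A \<inter> generic n)) \<le> (2 ^ card W) ^ (n div L + 1)" if "A \<in> \<C>" for A
      using \<delta>(2) \<C>(3)[OF that] by (intro card_itinerary_image_le[of L \<delta>]) auto
    from card_UN_le_mult[OF \<C>(1), of "\<lambda>A. itin n ` (A \<inter> generic n)", OF this]
    have count: "finite (\<Union>A\<in>\<C>. itin n ` (A \<inter> generic n))"
      "card (\<Union>A\<in>\<C>. itin n ` (A \<inter> generic n)) \<le> card \<C> * (2 ^ card W) ^ (n div L + 1)"
      by blast+
    have generic_cover: "generic n \<subseteq> (\<Union>A\<in>\<C>. A \<inter> generic n)"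
      using generic_subset_regular_set[OF \<open>0 < n\<close>] \<C>(2) by blast
    have "itin n ` adm n \<subseteq> itin n ` generic n"
      using exists_generic_same_itinerary[OF _ \<open>0 < n\<close>] by (metis image_subsetI rev_image_eqI)
    also have "\<dots> \<subseteq> (\<Union>A\<in>\<C>. itin n ` (A \<inter> generic n))"
      using image_mono[OF generic_cover, of "itin n"] by (simp only: image_UN)
    finally have cover: "itin n ` adm n \<subseteq> (\<Union>A\<in>\<C>. itin n ` (A \<inter> generic n))" .
    have "card (join_atoms T U n) \<le> card (itin n ` adm n)"
      using partition_U finite_subset[OF cover count(1)]
      by (intro card_join_atoms_le_card_itineraries) (auto simp: polygon_partition_def)
    also have "\<dots> \<le> card (\<Union>A\<in>\<C>. itin n ` (A \<inter> generic n))" using count(1) cover by (rule card_mono)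
    finally show ?thesis using count(2) by simp
  qed
  then show ?thesis by blast
qed

lemma partition_entropy_le_0: "partition_entropy T U \<le> 0"
proof -
  let ?h = "ln (real (2 ^ card W))"
  have bound: "partition_entropy T U \<le> ereal (?h / real L)" if L: "0 < L" for L
  proof -
    obtain c where "\<And>n. 0 < n \<Longrightarrow> card (join_atoms T U n) \<le> c * (2 ^ card W) ^ (n div L + 1)"
      using card_join_atoms_le[OF L] by blast
    then show ?thesis by (intro partition_entropy_le one_le_power) simp_all
  qed
  have "(\<lambda>L. ereal (?h / real L)) \<longlonglongrightarrow> 0"
    using lim_const_over_n[of ?h] by (simp add: zero_ereal_def)
  then show ?thesis
    by (rule tendsto_lowerbound) (use bound in \<open>auto intro!: eventually_sequentiallyI[of 1]\<close>)
qed

end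

context rational_billiard
begin

lemma rel_frontier_subset_parallel_planes:
  assumes "open_polygon A"
  shows "\<exists>K. \<forall>P v. A = P \<times> {v} \<longrightarrow> parallel_planes v K \<and> rel_frontier P \<subseteq> planes_Union K"
proof -
  obtain P v where P: "A = P \<times> {v}" "P \<noteq> {}" "segment_covered (rel_frontier P)"
    using assms unfolding open_polygon_def segment_covered_def by blast
  then obtain K where "parallel_planes v K" "rel_frontier P \<subseteq> planes_Union K"
    using segment_covered_subset_parallel_planes[of "rel_frontier P" v] by auto
  then show ?thesis using P(1,2) by (intro exI[of _ K]) (auto simp: times_eq_iff)
qed

text \<open>Closing the finitely many normals under the finite group makes the set of cut directions
  independent of the number of iterations.\<close>

lemma cut_system_exists:
  assumes U: "polygon_partition S U" "refines U R"
  shows "\<exists>W Z. cut_system V I F N \<omega> U W Z"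
proof -
  have poly: "finite U" "\<And>A. A \<in> U \<Longrightarrow> open_polygon A"
    using U(1) by (simp_all add: polygon_partition_def)
  obtain K where K: "\<And>P v. P \<times> {v} \<in> U \<Longrightarrow>
      parallel_planes v (K (P \<times> {v})) \<and> rel_frontier P \<subseteq> planes_Union (K (P \<times> {v}))"
    using rel_frontier_subset_parallel_planes[OF poly(2)] by metis
  have K_U: "finite (K A)" "0 \<notin> fst ` K A" if "A \<in> U" for A
    using K poly(2)[OF that] that by (fastforce simp: open_polygon_def parallel_planes_def)+
  let ?normals = "\<Union>A\<in>U. fst ` K A" and ?Z = "\<Union>A\<in>U. snd ` K A"
  have "cut_system V I F N \<omega> U (orbit ?normals) ?Z"
  proof unfold_locales
    show "polygon_partition S U" "refines U R" by fact+
    show "finite (orbit ?normals)" "finite ?Z" using poly(1) K_U(1) by (auto intro: finite_orbit)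
    show "0 \<notin> orbit ?normals" using K_U(2) by (simp add: zero_in_orbit_iff)
    show "reflect (N i) w \<in> orbit ?normals" if "w \<in> orbit ?normals" "i \<in> I" for w i
      using that by (rule reflect_in_orbit)
    show "rel_frontier P \<subseteq> planes_Union ({w \<in> orbit ?normals. w \<bullet> v = 0} \<times> ?Z)"
      if P: "P \<times> {v} \<in> U" for P v
    proof -
      have "w \<in> orbit ?normals \<and> w \<bullet> v = 0 \<and> d \<in> ?Z" if "(w, d) \<in> K (P \<times> {v})" for w d
      proof -
        have "w \<in> ?normals" "d \<in> ?Z" using that P by force+
        moreover have "w \<bullet> v = 0" using that K[OF P] by (auto simp: parallel_planes_def)
        ultimately show ?thesis using subsetD[OF orbit_superset] by simp
      qed
      then have "K (P \<times> {v}) \<subseteq> {w \<in> orbit ?normals. w \<bullet> v = 0} \<times> ?Z" by auto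
      then show ?thesis using K[OF P] planes_Union_mono by blast
    qed
  qed
  then show ?thesis by blast
qed

theorem poly_entropy_billiard_map: "poly_entropy S R T = 0"
proof (rule antisym)
  show "poly_entropy S R T \<le> 0"
    unfolding poly_entropy_def
    using cut_system_exists cut_system.partition_entropy_le_0 by (intro SUP_least) blast
  have "0 \<le> partition_entropy T R" by (rule partition_entropy_nonneg)
  also have "\<dots> \<le> poly_entropy S R T"
    unfolding poly_entropy_def
    by (rule SUP_upper) (auto simp: polygon_partition_discont_partition refines_def)
  finally show "0 \<le> poly_entropy S R T" .
qed

end

theorem theorem9:
  fixes V :: "pt set" and I :: "'i set" and F :: "'i \<Rightarrow> pt set" and N :: "'i \<Rightarrow> pt"
    and \<Omega> :: "pt set" and \<omega> :: pt
  assumes "rational_polytop V I F N"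
    and "fundamental_polygon (refl_group I N) \<Omega>"
    and "\<omega> \<in> \<Omega>"
  shows "gen_polygon_exchange (cross_section I F N \<omega>) (discont_partition V I F N \<omega>)
           (billiard_map V I F N)
       \<and> poly_entropy (cross_section I F N \<omega>) (discont_partition V I F N \<omega>)
           (billiard_map V I F N) = 0"
proof -
  interpret rational_billiard V I F N \<omega>
    using assms(1) by unfold_locales (auto simp: rational_polytop_def)
  show ?thesis using gen_polygon_exchange_billiard_map poly_entropy_billiard_map by blast
qed

end
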